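(* Let the $A_i$, $i\in I$, be nearly closed, and let $$\sum_{i\in I}a_i\,g_{i,\inf}^{-1}<\infty,\qquad \sup_{(x,y)\in\breve A^+\times\breve A^-}\kappa(x,y)<\infty,\qquad \sup_{x\in\breve A_i}g_i(x)<\infty\ \text{ for all } i\in I,$$ where $g_{i,\inf}:=\inf_{x\in A_i}g_i(x)$. Assume that for every $i\in I_0$, $\xi^i|_K\in\mathcal E^+_\kappa(X)$ for every compact $K\subset A_i^\circ$ and $\xi^i(A_i\setminus A_i^\circ)=0$, where $A_i^\circ:=\{x\in A_i:|f_i(x)|<\infty\}$, and that the restrictions $f_i|_{\breve A_i}$, $i\in I$, are lower bounded. Assume moreover that $\kappa$ is continuous on $\breve A^+\times\breve A^-$ and that Case I holds, i.e. $f_i\in\Psi(X)$ for all $i\in I$. Let $\boldsymbol\lambda\in\mathcal E^{\boldsymbol\sigma}_{\kappa,\mathbf f}(\mathbf A,\mathbf a,\mathbf g)$ and $(w^i_{\boldsymbol\lambda})_{i\in I}\in\mathbb R^{\mathrm{Card}\,I}$ be such that $$W^{\boldsymbol\lambda,i}_{\kappa,\mathbf f}\geqslant w^i_{\boldsymbol\lambda}g_i\ \ (\xi^i-\lambda^i)\text{-a.e. for all }i\in I_0,\qquad W^{\boldsymbol\lambda,i}_{\kappa,\mathbf f}\geqslant w^i_{\boldsymbol\lambda}g_i\ \text{ n.e. on }A_i\text{ for all }i\in I\setminus I_0.$$ Then the relations $$W^{\boldsymbol\lambda,i}_{\kappa,\mathbf f}\leqslant w^i_{\boldsymbol\lambda}g_i\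 \ \lambda^i\text{-a.e. for all }i\in I_0,\qquad W^{\boldsymbol\lambda,i}_{\kappa,\mathbf f}=w^i_{\boldsymbol\lambda}g_i\ \ \lambda^i\text{-a.e. for all }i\in I\setminus I_0$$ are equivalent to the following apparently stronger relations: $$W^{\boldsymbol\lambda,i}_{\kappa,\mathbf f}(x)\leqslant w^i_{\boldsymbol\lambda}g_i(x)\ \text{ for all }x\in S(\lambda^i)\text{ and all }i\in I_0,$$ $$W^{\boldsymbol\lambda,i}_{\kappa,\mathbf f}(x)=w^i_{\boldsymbol\lambda}g_i(x)\ \text{ for nearly all }x\in S(\lambda^i)\text{ and all }i\in I\setminus I_0.$$
   Context: **Measures and kernels.** $X$ is a locally compact Hausdorff space, $\mathfrak M(X)$ the space of real-valued (signed) Radon measures on $X$, $\mathfrak M^+(X)$ its positive elements; $S(\nu)$ is the support of $\nu$. Continuous functions are finite-valued. $\nu\in\mathfrak M^+(X)$ is carried by $Q\subset X$ if $X\setminus Q$ is locally $\nu$-negligible (equivalently, $Q$ is $\nu$-measurable and $\nu=\nu|_Q$); $\mathfrak M^+(Q)$ is the set of such $\nu$. $\langle\psi,\nu\rangle:=\int\psi\,d\nu$. For a topological space $Y$, $\Psi(Y)$ is the set of l.s.c. functions $Y\to(-\infty,\infty]$, required to be nonnegative unless $Y$ is compact. A kernel is a symmetric $\kappa\in\Psi(X\times X)$. Write $\kappa(\mu,\nu):=\int\kappa\,d(\mu\otimes\nu)$ and $\kappa(x,\nu):=\int\kappa(x,y)\,d\nu(y)$. The kernel is assumed positive definite: $\kappa(\nu,\nu)\geqslant0$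 for every $\nu\in\mathfrak M(X)$ for which it is defined (i.e. $\kappa(\nu^+,\nu^+)+\kappa(\nu^-,\nu^-)$ or $\kappa(\nu^+,\nu^-)$ is finite). $\mathcal E_\kappa(X):=\{\nu\in\mathfrak M(X):\kappa(\nu,\nu)\text{ finite}\}$; $\mathcal E^+_\kappa(Q):=\mathcal E_\kappa(X)\cap\mathfrak M^+(Q)$. The inner capacity is $c_\kappa(Q):=\bigl[\inf\{\kappa(\nu,\nu):\nu\in\mathcal E_\kappa^+(Q),\ \nu(Q)=1\}\bigr]^{-1}$ ($\inf\varnothing=+\infty$, $1/(+\infty)=0$, $1/0=+\infty$). A property holds nearly everywhere (n.e.) on $Q$, or for nearly all $x\in Q$, if the set of exceptional points in $Q$ has $c_\kappa$-capacity zero. **Condenser.** $I=I^+\cup I^-$ is a countable index set, $I^+\cap I^-=\varnothing$ ($I^-$ may be empty), $s_i:=+1$ for $i\in I^+$, $s_i:=-1$ for $i\in I^-$. $\mathbf A=(A_i)_{i\in I}$ is a generalized condenser: nonempty Borel sets $A_i\subset X$ such that every compact set meets at most finitely many $A_i$, and $A_i\cap A_j=\varnothing$ for $i\in I^+$, $j\in I^-$. A set $Q\subset X$ is nearly closed if there is a closed set $\breve Q$ with $c_\kappa(Q\bigtriangleup\breve Q)=0$. For nearly closed $A_i$, $\breve A_i$ denotes such a closed set, with $(\breve A_i)_{i\in I}$ locally finite, and $\breve A^{\pm}:=\bigcup_{i\in I^\pm}\breve A_i$. **Vector measures.** $\mathfrak M^+(\mathbf A):=\prod_{i\in I}\mathfrak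 M^+(A_i)$. A numerical series over $I$ is finite iff it has finite terms and converges absolutely. The energy of $\boldsymbol\mu=(\mu^i)_{i\in I}\in\mathfrak M^+(\mathbf A)$ is $\kappa(\boldsymbol\mu,\boldsymbol\mu):=\sum_{i,j\in I}s_is_j\kappa(\mu^i,\mu^j)$; $\mathcal E^+_\kappa(\mathbf A)$ is the set of $\boldsymbol\mu$ with finite energy. For $\boldsymbol\mu\in\mathcal E^+_\kappa(\mathbf A)$ the vector potential has components $\kappa^i_{\boldsymbol\mu}(x):=\sum_{j\in I}s_is_j\kappa(x,\mu^j)$, $i\in I$, and the $\mathbf f$-weighted vector potential has components $W^{\boldsymbol\mu,i}_{\kappa,\mathbf f}:=\kappa^i_{\boldsymbol\mu}+f_i$, $i\in I$. **The problem.** Given: $\mathbf a=(a_i)_{i\in I}$, $a_i>0$; $\mathbf g=(g_i)_{i\in I}$ with continuous $g_i:X\to(0,\infty)$; an external field $\mathbf f=(f_i)_{i\in I}$, $f_i:X\to[-\infty,\infty]$ universally measurable; $I_0\subset I$ (possibly empty); constraints $\xi^i\in\mathfrak M^+(A_i)$, $i\in I_0$, with $\langle g_i,\xi^i\rangle>a_i$. Put $\sigma^i=\xi^i$ for $i\in I_0$, $\sigma^i=\infty$ (no constraint) for $i\in I\setminus I_0$, $\boldsymbol\sigma=(\sigma^i)_{i\in I}$. $\mathcal E^{\boldsymbol\sigma}_{\kappa,\mathbf f}(\mathbf A,\mathbf a,\mathbf g)$ is the set of $\boldsymbol\mu\in\mathcal E_\kappa^+(\mathbf A)$ with $\langle g_i,\mu^i\rangle=a_i$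 for all $i\in I$, $\mu^i\leqslant\xi^i$ for all $i\in I_0$, and $\langle\mathbf f,\boldsymbol\mu\rangle:=\sum_{i\in I}\langle f_i,\mu^i\rangle$ finite. **Permanent assumptions.** $\mathcal E^{\boldsymbol\sigma}_{\kappa,\mathbf f}(\mathbf A,\mathbf a,\mathbf g)\ne\varnothing$. Either $X$ is countable at infinity (a countable union of compact sets), or $\inf_{A_i}g_i>0$ for all $i\in I$. *)

theory Defs
  imports "HOL-Analysis.Analysis"
begin

section \<open>Radon measures\<close>

text \<open>
  A positive Radon measure on a locally compact Hausdorff space (a positive functional on the
  continuous functions of compact support) is represented by its principal Borel measure:
  outer regular on Borel sets and inner regular on open sets.  With this representative
  \<^term>\<open>null_sets (completion M)\<close> are the negligible sets in Bourbaki's sense (outer measure zero),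
  \<open>AE x in M\<close> is Bourbaki's ``almost everywhere'', and \<open>nn_integral\<close> is the upper integral on
  nonnegative Borel functions; the weaker notion ``locally negligible'' is separate.
\<close>

definition radon_measure :: "'a::t2_space measure \<Rightarrow> bool" where
  "radon_measure M \<longleftrightarrow>
     sets M = sets borel \<and>
     (\<forall>K. compact K \<longrightarrow> emeasure M K < \<infinity>) \<and>
     (\<forall>B\<in>sets borel. emeasure M B = (INF U\<in>{U. open U \<and> B \<subseteq> U}. emeasure M U)) \<and>
     (\<forall>U. open U \<longrightarrow> emeasure M U = (SUP K\<in>{K. compact K \<and> K \<subseteq> U}. emeasure M K))"

definition locally_negligible :: "'a::t2_space measure \<Rightarrow> 'a set \<Rightarrow> bool" where
  "locally_negligible M N \<longleftrightarrow> (\<forall>K. compact K \<longrightarrow> N \<inter> K \<in> null_sets (completion M))"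

definition radon_carried :: "'a::t2_space set \<Rightarrow> 'a measure set" where
  "radon_carried Q = {\<nu>. radon_measure \<nu> \<and> locally_negligible \<nu> (- Q)}"

definition msupport :: "'a::t2_space measure \<Rightarrow> 'a set" where
  "msupport \<nu> = {x. \<forall>U. open U \<and> x \<in> U \<longrightarrow> emeasure \<nu> U > 0}"

definition universally_measurable :: "('a::t2_space \<Rightarrow> ereal) \<Rightarrow> bool" where
  "universally_measurable f \<longleftrightarrow>
     (\<forall>M K. radon_measure M \<and> compact K \<longrightarrow> f \<in> borel_measurable (restrict_space (completion M) K))"

text \<open>
  Integrals and series with values in \<^typ>\<open>ereal\<close>: positive part minus negative part.  Since
  \<open>\<infinity> - \<infinity> = \<infinity>\<close> in \<^typ>\<open>ereal\<close>, the value is finite iff both parts are finite, that is, iff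
  the integral (series) converges absolutely.
\<close>

definition pairing :: "('a \<Rightarrow> ereal) \<Rightarrow> 'a measure \<Rightarrow> ereal" where
  "pairing \<psi> \<nu> = enn2ereal (\<integral>\<^sup>+x. e2ennreal (\<psi> x) \<partial>\<nu>) - enn2ereal (\<integral>\<^sup>+x. e2ennreal (- \<psi> x) \<partial>\<nu>)"

definition ereal_series :: "('j \<Rightarrow> ereal) \<Rightarrow> 'j set \<Rightarrow> ereal" where
  "ereal_series t J =
     enn2ereal (\<Sum>\<^sub>\<infinity>j\<in>J. e2ennreal (t j)) - enn2ereal (\<Sum>\<^sub>\<infinity>j\<in>J. e2ennreal (- t j))"

definition finite_series :: "('j \<Rightarrow> ereal) \<Rightarrow> 'j set \<Rightarrow> bool" where
  "finite_series t J \<longleftrightarrow>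
     (\<forall>j\<in>J. \<bar>t j\<bar> \<noteq> \<infinity>) \<and> (\<lambda>j. \<bar>real_of_ereal (t j)\<bar>) summable_on J"


section \<open>Kernels, energy and inner capacity\<close>

definition Psi_class :: "('a::topological_space \<Rightarrow> ereal) set" where
  "Psi_class = {\<psi>. (\<forall>t. open {x. t < \<psi> x}) \<and> (\<forall>x. \<psi> x \<noteq> -\<infinity>) \<and>
                   (compact (UNIV :: 'a set) \<or> (\<forall>x. 0 \<le> \<psi> x))}"

definition kernel :: "('a::t2_space \<times> 'a \<Rightarrow> ereal) \<Rightarrow> bool" where
  "kernel \<kappa> \<longleftrightarrow> \<kappa> \<in> Psi_class \<and> (\<forall>x y. \<kappa> (x, y) = \<kappa> (y, x))"

definition Cc :: "('b::topological_space \<Rightarrow> real) set" where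
  "Cc = {\<phi>. continuous_on UNIV \<phi> \<and> compact (closure {x. \<phi> x \<noteq> 0})}"

text \<open>
  Without second countability the \<open>\<sigma>\<close>-algebra of the library's product measure can be strictly
  smaller than the Borel \<open>\<sigma>\<close>-algebra of \<open>X \<times> X\<close>, and a lower semicontinuous \<open>\<kappa>\<close> need not be
  measurable for it.  Therefore \<open>\<mu> \<otimes> \<nu>\<close> is taken as Bourbaki defines it, as a functional on
  \<open>C\<^sub>c(X \<times> X)\<close>, and it is extended to functions of class \<open>\<Psi>\<close> by the usual supremum.
  (For \<open>\<kappa> \<ge> 0\<close> it makes no difference that \<open>\<phi>\<close> may take negative values.)
\<close>

definition radon_tensor :: "'a::t2_space measure \<Rightarrow> 'a measure \<Rightarrow> ('a \<times> 'a \<Rightarrow> real) \<Rightarrow> real" where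
  "radon_tensor \<mu> \<nu> \<phi> = (\<integral>x. (\<integral>y. \<phi> (x, y) \<partial>\<nu>) \<partial>\<mu>)"

definition mutual_energy ::
    "('a::t2_space \<times> 'a \<Rightarrow> ereal) \<Rightarrow> 'a measure \<Rightarrow> 'a measure \<Rightarrow> ereal" where
  "mutual_energy \<kappa> \<mu> \<nu> =
     (SUP \<phi>\<in>{\<phi>\<in>Cc. \<forall>p. ereal (\<phi> p) \<le> \<kappa> p}. ereal (radon_tensor \<mu> \<nu> \<phi>))"

definition potential :: "('a::t2_space \<times> 'a \<Rightarrow> ereal) \<Rightarrow> 'a measure \<Rightarrow> 'a \<Rightarrow> ereal" where
  "potential \<kappa> \<nu> x = pairing (\<lambda>y. \<kappa> (x, y)) \<nu>"

text \<open>
  A signed Radon measure \<open>\<nu>\<close> enters through its Jordan decomposition \<open>(\<nu>\<^sup>+, \<nu>\<^sup>-)\<close>: a pair of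
  positive Radon measures whose infimum in the lattice of Radon measures is zero.
\<close>

definition radon_disjoint :: "'a::t2_space measure \<Rightarrow> 'a measure \<Rightarrow> bool" where
  "radon_disjoint p n \<longleftrightarrow> (\<forall>\<rho>. radon_measure \<rho> \<and> \<rho> \<le> p \<and> \<rho> \<le> n \<longrightarrow> emeasure \<rho> UNIV = 0)"

definition positive_definite_kernel :: "('a::t2_space \<times> 'a \<Rightarrow> ereal) \<Rightarrow> bool" where
  "positive_definite_kernel \<kappa> \<longleftrightarrow> kernel \<kappa> \<and>
     (\<forall>p n. radon_measure p \<and> radon_measure n \<and> radon_disjoint p n \<longrightarrow>
        \<bar>mutual_energy \<kappa> p p + mutual_energy \<kappa> n n\<bar> \<noteq> \<infinity> \<or> \<bar>mutual_energy \<kappa> p n\<bar> \<noteq> \<infinity> \<longrightarrow>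
        0 \<le> mutual_energy \<kappa> p p + mutual_energy \<kappa> n n - 2 * mutual_energy \<kappa> p n)"

definition finite_energy_pos :: "('a::t2_space \<times> 'a \<Rightarrow> ereal) \<Rightarrow> 'a set \<Rightarrow> 'a measure set" where
  "finite_energy_pos \<kappa> Q = {\<nu> \<in> radon_carried Q. \<bar>mutual_energy \<kappa> \<nu> \<nu>\<bar> \<noteq> \<infinity>}"

text \<open>
  \<open>Q\<close> is arbitrary.  If \<open>\<nu>\<close> is carried by \<open>Q\<close> and has total mass 1, then \<open>Q\<close> is measurable for
  the completion.  In \<^typ>\<open>ereal\<close>, \<open>inverse 0 = \<infinity>\<close>, \<open>inverse \<infinity> = 0\<close> and \<open>INF\<close> over \<open>{}\<close> is \<open>\<infinity>\<close>.
\<close>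

definition inner_capacity :: "('a::t2_space \<times> 'a \<Rightarrow> ereal) \<Rightarrow> 'a set \<Rightarrow> ereal" where
  "inner_capacity \<kappa> Q =
     inverse (INF \<nu>\<in>{\<nu> \<in> finite_energy_pos \<kappa> Q. emeasure (completion \<nu>) Q = 1}. mutual_energy \<kappa> \<nu> \<nu>)"

definition nearly_everywhere ::
    "('a::t2_space \<times> 'a \<Rightarrow> ereal) \<Rightarrow> 'a set \<Rightarrow> ('a \<Rightarrow> bool) \<Rightarrow> bool" where
  "nearly_everywhere \<kappa> Q P \<longleftrightarrow> inner_capacity \<kappa> {x \<in> Q. \<not> P x} = 0"

text \<open>\<open>nearly_closed_by \<kappa> Q C\<close>: \<open>Q\<close> is nearly closed, with \<open>C\<close> as the closed set.\<close>

definition nearly_closed_by :: "('a::t2_space \<times> 'a \<Rightarrow> ereal) \<Rightarrow> 'a set \<Rightarrow> 'a set \<Rightarrow> bool" where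
  "nearly_closed_by \<kappa> Q C \<longleftrightarrow> closed C \<and> inner_capacity \<kappa> ((Q - C) \<union> (C - Q)) = 0"


section \<open>Condensers and vector measures\<close>

text \<open>
  The index set is \<open>I = Ipos \<union> Ineg\<close>; families over \<open>I\<close> are functions on the whole index type whose
  values outside \<open>I\<close> play no role.
\<close>

definition generalized_condenser ::
    "'i set \<Rightarrow> 'i set \<Rightarrow> ('i \<Rightarrow> 'a::t2_space set) \<Rightarrow> bool" where
  "generalized_condenser Ipos Ineg A \<longleftrightarrow>
     countable (Ipos \<union> Ineg) \<and> Ipos \<inter> Ineg = {} \<and>
     (\<forall>i\<in>Ipos \<union> Ineg. A i \<in> sets borel \<and> A i \<noteq> {}) \<and>
     (\<forall>K. compact K \<longrightarrow> finite {i \<in> Ipos \<union> Ineg. A i \<inter> K \<noteq> {}}) \<and>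
     (\<forall>i\<in>Ipos. \<forall>j\<in>Ineg. A i \<inter> A j = {})"

definition locally_finite_family :: "'i set \<Rightarrow> ('i \<Rightarrow> 'a::topological_space set) \<Rightarrow> bool" where
  "locally_finite_family J B \<longleftrightarrow> (\<forall>x. \<exists>U. open U \<and> x \<in> U \<and> finite {i \<in> J. B i \<inter> U \<noteq> {}})"

definition plate_sign :: "'i set \<Rightarrow> 'i \<Rightarrow> ereal" where
  "plate_sign Ipos i = (if i \<in> Ipos then 1 else -1)"

definition finite_energy_vectors ::
    "('a::t2_space \<times> 'a \<Rightarrow> ereal) \<Rightarrow> 'i set \<Rightarrow> 'i set \<Rightarrow> ('i \<Rightarrow> 'a set) \<Rightarrow> ('i \<Rightarrow> 'a measure) set" where
  "finite_energy_vectors \<kappa> Ipos Ineg A =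
     {\<mu>. (\<forall>i\<in>Ipos \<union> Ineg. \<mu> i \<in> radon_carried (A i)) \<and>
         finite_series (\<lambda>(i, j). plate_sign Ipos i * plate_sign Ipos j * mutual_energy \<kappa> (\<mu> i) (\<mu> j))
           ((Ipos \<union> Ineg) \<times> (Ipos \<union> Ineg))}"

text \<open>
  At points where the series is of the undefined form \<open>\<infinity> - \<infinity>\<close> it gets the junk value \<open>\<infinity>\<close>.
  When \<open>\<kappa>\<close> is bounded above on a product of the two plates and the masses are summable, as in the
  theorem, this does not happen on those plates.
\<close>

definition vector_potential ::
    "('a::t2_space \<times> 'a \<Rightarrow> ereal) \<Rightarrow> 'i set \<Rightarrow> 'i set \<Rightarrow> ('i \<Rightarrow> 'a measure) \<Rightarrow> 'i \<Rightarrow> 'a \<Rightarrow> ereal" where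
  "vector_potential \<kappa> Ipos Ineg \<mu> i x =
     ereal_series (\<lambda>j. plate_sign Ipos i * plate_sign Ipos j * potential \<kappa> (\<mu> j) x) (Ipos \<union> Ineg)"

definition weighted_potential ::
    "('a::t2_space \<times> 'a \<Rightarrow> ereal) \<Rightarrow> 'i set \<Rightarrow> 'i set \<Rightarrow> ('i \<Rightarrow> 'a \<Rightarrow> ereal) \<Rightarrow>
     ('i \<Rightarrow> 'a measure) \<Rightarrow> 'i \<Rightarrow> 'a \<Rightarrow> ereal" where
  "weighted_potential \<kappa> Ipos Ineg f \<mu> i x = vector_potential \<kappa> Ipos Ineg \<mu> i x + f i x"

text \<open>The constraint \<open>\<sigma>\<close> is \<open>\<xi> i\<close> for \<open>i \<in> I0\<close> and absent (\<open>\<infinity>\<close>) otherwise.\<close>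

definition admissible_vectors ::
    "('a::t2_space \<times> 'a \<Rightarrow> ereal) \<Rightarrow> 'i set \<Rightarrow> 'i set \<Rightarrow> ('i \<Rightarrow> 'a set) \<Rightarrow> ('i \<Rightarrow> real) \<Rightarrow>
     ('i \<Rightarrow> 'a \<Rightarrow> real) \<Rightarrow> ('i \<Rightarrow> 'a \<Rightarrow> ereal) \<Rightarrow> 'i set \<Rightarrow> ('i \<Rightarrow> 'a measure) \<Rightarrow>
     ('i \<Rightarrow> 'a measure) set" where
  "admissible_vectors \<kappa> Ipos Ineg A a g f I0 \<xi> =
     {\<mu> \<in> finite_energy_vectors \<kappa> Ipos Ineg A.
        (\<forall>i\<in>Ipos \<union> Ineg. pairing (\<lambda>x. ereal (g i x)) (\<mu> i) = ereal (a i)) \<and>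
        (\<forall>i\<in>I0. \<mu> i \<le> \<xi> i) \<and>
        finite_series (\<lambda>i. pairing (f i) (\<mu> i)) (Ipos \<union> Ineg)}"

definition countable_at_infinity :: "'a::topological_space itself \<Rightarrow> bool" where
  "countable_at_infinity _ \<longleftrightarrow>
     (\<exists>\<K> :: 'a set set. countable \<K> \<and> (\<forall>K\<in>\<K>. compact K) \<and> \<Union>\<K> = UNIV)"

definition finite_part :: "('a \<Rightarrow> ereal) \<Rightarrow> 'a set \<Rightarrow> 'a set" where
  "finite_part f Q = {x \<in> Q. \<bar>f x\<bar> < \<infinity>}"

end

theory Submission
  imports Defs
begin

text \<open>
  Sets of capacity zero are negligible for measures of finite energy, so each \<open>\<lambda>\<^sup>i\<close> is concentrated on
  the closed set \<open>C\<^sub>i\<close> that nearly equals \<open>A\<^sub>i\<close>, and \<open>S(\<lambda>\<^sup>i) \<subseteq> C\<^sub>i\<close>.  On \<open>C\<^sub>i\<close> the weighted potential is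
  lower semicontinuous: potentials of plates of the same sign are l.s.c. because the kernel is, while
  minus the potential of a plate of the opposite sign is the integral of a continuous function that
  is bounded below.  Therefore \<open>W > w g\<close> holds on a relatively open subset of \<open>C\<^sub>i\<close>, and if this subset
  is \<open>\<lambda>\<^sup>i\<close>-null, it misses the support.  The opposite inequality holds nearly everywhere on \<open>A\<^sub>i\<close>, thus
  on the support up to the capacity-zero set \<open>C\<^sub>i - A\<^sub>i\<close>.  Conversely, relations on the support can fail
  only on a \<open>\<lambda>\<^sup>i\<close>-null set.
\<close>


section \<open>Radon measures and their supports\<close>

text \<open>The delicate point is the sum defining the vector potential: in \<open>ereal\<close> the
  form \<infinity> - \<infinity> has the value \<infinity>, so terms of both signs cannot simply be
  rearranged. One constant \<open>C\<close> settles this: - \<open>C\<close> bounds the kernel below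
  everywhere and \<open>C\<close> bounds it above between opposite plates, so every signed kernel
  plus \<open>C\<close> is nonnegative on the product that matters. The total shift is
  \<open>C\<close> times the sum of the masses. It is finite since the mass of \<open>lam i\<close>
  is at most \<open>a i\<close> divided by the infimum of \<open>g i\<close> on \<open>A i\<close>;
  this is where the summability hypothesis enters. The space may be neither metrizable nor second
  countable. Hence semicontinuity of potentials is not a matter of Fatou along sequences but of
  compact pieces of level sets and the tube lemma, and energies are estimated through test functions
  in \<open>Cc\<close>. The two kinds of indices differ because equality on the support also needs a
  lower bound. Nearly everywhere on \<open>A i\<close> it is given only off \<open>I0\<close>; for
  constrained indices only the upper bound is carried to the support.\<close>

lemma radon_sets:
  assumes "radon_measure M"
  shows radon_measure_sets: "sets M = sets borel" and radon_measure_space: "space M = UNIV"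
proof -
  show "sets M = sets borel" using assms by (simp add: radon_measure_def)
  then show "space M = UNIV" using sets_eq_imp_space_eq by fastforce
qed

lemma radon_compact_finite:
  assumes "radon_measure M" "compact K"
  shows "emeasure M K < \<infinity>"
  using assms(2) assms(1)[unfolded radon_measure_def, THEN conjunct2, THEN conjunct1] by blast

lemma radon_outer_regular:
  assumes "radon_measure M" "B \<in> sets borel"
  shows "emeasure M B = (INF U\<in>{U. open U \<and> B \<subseteq> U}. emeasure M U)"
  by (rule bspec[OF assms(1)[unfolded radon_measure_def, THEN conjunct2, THEN conjunct2, THEN conjunct1] assms(2)])

lemma radon_inner_regular_open:
  assumes "radon_measure M" "open U"
  shows "emeasure M U = (SUP K\<in>{K. compact K \<and> K \<subseteq> U}. emeasure M K)"
  by (rule assms(1)[unfolded radon_measure_def, THEN conjunct2, THEN conjunct2, THEN conjunct2, rule_format, OF assms(2)])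

text \<open>Enclose \<open>B\<close> in an open \<open>V\<close> of finite measure, fill
  \<open>V\<close> up to e/2 by a compact \<open>L\<close>, and cover \<open>V - B\<close> by an
  open \<open>W\<close> with excess at most e/2. Then \<open>L - W\<close> is compact, lies in
  \<open>B\<close>, and misses at most e of its mass.\<close>

lemma radon_inner_regular:
  fixes M :: "'a::t2_space measure"
  assumes M: "radon_measure M" and B: "B \<in> sets borel" and fin: "emeasure M B < \<infinity>"
  shows "emeasure M B = (SUP K\<in>{K. compact K \<and> K \<subseteq> B}. emeasure M K)"
proof (rule antisym)
  note [simp] = radon_measure_sets[OF M] radon_measure_space[OF M]
  note outer = radon_outer_regular[OF M] and inner = radon_inner_regular_open[OF M]
  show "(SUP K\<in>{K. compact K \<and> K \<subseteq> B}. emeasure M K) \<le> emeasure M B"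
    using B by (intro SUP_least emeasure_mono) auto
  show "emeasure M B \<le> (SUP K\<in>{K. compact K \<and> K \<subseteq> B}. emeasure M K)"
  proof (rule ennreal_le_epsilon)
    fix e :: real assume e: "0 < e"
    obtain V where V: "open V" "B \<subseteq> V" "emeasure M V < emeasure M B + ennreal 1"
      using INF_approx_ennreal[OF _ outer[OF B], of 1] fin by (auto simp: less_top)
    have Vfin: "emeasure M V < top"
      using V(3) fin by (auto simp: less_top[symmetric] ennreal_add_eq_top)
    have [measurable]: "V \<in> sets borel" "B \<in> sets borel" using V(1) B by auto
    have VB: "emeasure M (V - B) < \<infinity>"
      by (rule le_less_trans[OF _ Vfin[folded infinity_ennreal_def]]) (auto intro!: emeasure_mono)
    have e2: "0 < e/2" using e by simp
    have "{K. compact K \<and> K \<subseteq> V} \<noteq> {}" by (auto intro!: exI[of _ "{}"])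
    from SUP_approx_ennreal[OF e2 this inner[OF V(1)]] Vfin
    obtain L where L: "compact L" "L \<subseteq> V" "emeasure M V < emeasure M L + ennreal (e/2)"
      by (auto simp: less_top)
    from INF_approx_ennreal[OF e2 outer[of "V - B"]] VB
    obtain W where W: "open W" "V - B \<subseteq> W" "emeasure M W < emeasure M (V - B) + ennreal (e/2)"
      by (auto simp: less_top)
    have [measurable]: "L \<in> sets borel" "W \<in> sets borel" using L W by (auto intro: borel_compact)
    have K: "compact (L - W)" "L - W \<subseteq> B" using L W by (auto intro: compact_diff)
    have "emeasure M V = emeasure M L + emeasure M (V - L)"
      using L(2) by (subst plus_emeasure) (auto intro!: arg_cong[where f="emeasure M"])
    with L(3) have 1: "emeasure M (V - L) \<le> ennreal (e/2)"
      by (auto simp: ennreal_add_left_cancel_less)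
    \<comment> \<open>\<open>W\<close> exceeds \<open>V - B\<close> by little, so it can eat only
      little of \<open>B\<close>; cancelling is allowed because \<open>V - B\<close> has finite
      measure.\<close>
    have "emeasure M (V - B) + emeasure M (W \<inter> B) = emeasure M ((V - B) \<union> (W \<inter> B))"
      by (rule plus_emeasure) auto
    also have "\<dots> \<le> emeasure M W"
      using W(2) by (intro emeasure_mono) auto
    also note W(3)
    finally have 2: "emeasure M (W \<inter> B) \<le> ennreal (e/2)"
      by (auto simp: ennreal_add_left_cancel_less)
    have "emeasure M B \<le> emeasure M ((L - W) \<union> ((V - L) \<union> (W \<inter> B)))"
      using V(2) by (intro emeasure_mono) auto
    also have "\<dots> \<le> emeasure M (L - W) + emeasure M ((V - L) \<union> (W \<inter> B))"
      by (rule emeasure_subadditive) auto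
    also have "\<dots> \<le> emeasure M (L - W) + (emeasure M (V - L) + emeasure M (W \<inter> B))"
      by (intro add_left_mono emeasure_subadditive) auto
    also have "\<dots> \<le> emeasure M (L - W) + (ennreal (e/2) + ennreal (e/2))"
      using 1 2 by (intro add_left_mono add_mono)
    also have "ennreal (e/2) + ennreal (e/2) = ennreal e"
      using e by (simp flip: ennreal_plus)
    also have "emeasure M (L - W) \<le> (SUP K\<in>{K. compact K \<and> K \<subseteq> B}. emeasure M K)"
      using K by (intro SUP_upper) auto
    finally show "emeasure M B \<le> (SUP K\<in>{K. compact K \<and> K \<subseteq> B}. emeasure M K) + ennreal e"
      by (simp add: add_right_mono)
  qed
qed

lemma radon_positive_compact:
  assumes "radon_measure M" "B \<in> sets borel" "emeasure M B < \<infinity>" "emeasure M B \<noteq> 0"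
  obtains K where "compact K" "K \<subseteq> B" "0 < emeasure M K"
proof -
  have "0 < (SUP K\<in>{K. compact K \<and> K \<subseteq> B}. emeasure M K)"
    using radon_inner_regular[OF assms(1-3)] assms(4) by (simp add: zero_less_iff_neq_zero)
  then show ?thesis using that by (auto simp: less_SUP_iff)
qed

lemma radon_open_null:
  assumes M: "radon_measure M" and U: "open U" and null: "\<And>K. compact K \<Longrightarrow> K \<subseteq> U \<Longrightarrow> emeasure M K = 0"
  shows "emeasure M U = 0"
proof -
  have "emeasure M U = (SUP K\<in>{K. compact K \<and> K \<subseteq> U}. emeasure M K)"
    by (rule radon_inner_regular_open[OF M U])
  also have "\<dots> \<le> 0" using null by (intro SUP_least) auto
  finally show ?thesis by simp
qed

lemma open_Compl_msupport: "open (- msupport M)"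
proof (subst open_subopen, intro ballI)
  fix x assume "x \<in> - msupport M"
  then obtain U where U: "open U" "x \<in> U" "emeasure M U = 0"
    by (auto simp: msupport_def zero_less_iff_neq_zero)
  then have "U \<subseteq> - msupport M" by (auto simp: msupport_def)
  with U show "\<exists>T. open T \<and> x \<in> T \<and> T \<subseteq> - msupport M" by auto
qed

text \<open>The complement is a union of possibly uncountably many null open sets. Inner regularity
  on open sets reduces the claim to compact subsets, which finitely many of these sets
  cover.\<close>

lemma emeasure_Compl_msupport:
  assumes M: "radon_measure M"
  shows "emeasure M (- msupport M) = 0"
proof (rule radon_open_null[OF M open_Compl_msupport])
  fix K assume K: "compact K" "K \<subseteq> - msupport M"
  define \<U> where "\<U> = {U. open U \<and> emeasure M U = 0}"
  have "K \<subseteq> \<Union>\<U>" using K(2) by (auto simp: \<U>_def msupport_def zero_less_iff_neq_zero)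
  moreover have "\<And>U. U \<in> \<U> \<Longrightarrow> open U" by (auto simp: \<U>_def)
  ultimately obtain \<V> where V: "\<V> \<subseteq> \<U>" "finite \<V>" "K \<subseteq> \<Union>\<V>"
    using compactE[OF K(1)] by metis
  have sets: "\<And>U. U \<in> \<V> \<Longrightarrow> U \<in> sets M"
    using V(1) radon_measure_sets[OF M] by (auto simp: \<U>_def)
  have "\<Union>\<V> \<in> null_sets M"
    using V(1,2) sets by (intro null_sets.finite_Union) (auto simp: \<U>_def null_setsI)
  moreover have "K \<in> sets M" using K(1) radon_measure_sets[OF M] by (auto intro: borel_compact)
  ultimately show "emeasure M K = 0" using V(3) by (metis null_setsD1 null_sets_subset)
qed

lemma msupport_subset_closed:
  assumes "closed C" "emeasure M (- C) = 0"
  shows "msupport M \<subseteq> C"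
proof
  fix x assume x: "x \<in> msupport M"
  show "x \<in> C"
  proof (rule ccontr)
    assume "x \<notin> C"
    then have "0 < emeasure M (- C)" using x assms(1) unfolding msupport_def by blast
    then show False using assms(2) by simp
  qed
qed

text \<open>Supplies the competitors for the capacity. Inner regularity is that of \<open>M\<close>
  on the Borel set \<open>U \<inter> K\<close> of finite measure; outer regularity transfers because
  open neighbourhoods of \<open>B \<inter> K\<close> become neighbourhoods of \<open>B\<close> at no
  cost.\<close>

lemma radon_density_compact:
  fixes M :: "'a::t2_space measure"
  assumes M: "radon_measure M" and K: "compact K" and r: "0 < r"
  shows "radon_measure (density M (\<lambda>x. ennreal (r * indicator K x)))" (is "radon_measure ?N")
proof -
  note [simp] = radon_measure_sets[OF M] radon_measure_space[OF M]
  have Kb[measurable]: "K \<in> sets borel" using K by (auto intro: borel_compact)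
  have meas: "(\<lambda>x. ennreal (r * indicator K x)) \<in> borel_measurable M"
    by (subst measurable_cong_sets[OF radon_measure_sets[OF M] refl]) measurable
  have Nem: "emeasure ?N B = ennreal r * emeasure M (B \<inter> K)" if [measurable]: "B \<in> sets borel" for B
  proof -
    have "emeasure ?N B = (\<integral>\<^sup>+x. ennreal (r * indicator K x) * indicator B x \<partial>M)"
      by (rule emeasure_density[OF meas]) simp
    also have "\<dots> = (\<integral>\<^sup>+x. ennreal r * indicator (B \<inter> K) x \<partial>M)"
      by (intro nn_integral_cong) (auto split: split_indicator)
    finally show ?thesis by (simp add: nn_integral_cmult_indicator)
  qed
  have Kfin: "emeasure M K < \<infinity>" by (rule radon_compact_finite[OF M K])
  have finB: "emeasure M (B \<inter> K) < \<infinity>" if "B \<in> sets borel" for B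
    by (rule le_less_trans[OF _ Kfin]) (auto intro!: emeasure_mono)
  show ?thesis unfolding radon_measure_def
  proof (intro conjI ballI allI impI)
    show "sets ?N = sets borel" by simp
    fix L :: "'a set" assume "compact L"
    then have "L \<in> sets borel" by (auto intro: borel_compact)
    then show "emeasure ?N L < \<infinity>" using finB by (simp add: Nem ennreal_mult_less_top)
  next
    fix B :: "'a set" assume B[measurable]: "B \<in> sets borel"
    show "emeasure ?N B = (INF U\<in>{U. open U \<and> B \<subseteq> U}. emeasure ?N U)"
    proof (rule antisym)
      show "emeasure ?N B \<le> (INF U\<in>{U. open U \<and> B \<subseteq> U}. emeasure ?N U)"
        by (intro INF_greatest emeasure_mono) auto
      have "(INF U\<in>{U. open U \<and> B \<subseteq> U}. emeasure ?N U) \<le> ennreal r * emeasure M V"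
        if V: "open V" "B \<inter> K \<subseteq> V" for V
      \<comment> \<open>The added set \<open>- K\<close> is open, since compact sets in a Hausdorff
        space are closed, and the restricted measure does not charge it.\<close>
      proof (rule INF_lower2[of "V \<union> - K"])
        show "V \<union> - K \<in> {U. open U \<and> B \<subseteq> U}"
          using V K by (auto intro!: open_Un open_Compl compact_imp_closed)
        show "emeasure ?N (V \<union> - K) \<le> ennreal r * emeasure M V"
          using V by (subst Nem) (auto intro!: mult_left_mono emeasure_mono)
      qed
      note le = this
      show "(INF U\<in>{U. open U \<and> B \<subseteq> U}. emeasure ?N U) \<le> emeasure ?N B"
      proof (rule ennreal_le_epsilon)
        fix e :: real assume "0 < e"
        with r have "0 < e / r" by simp
        from INF_approx_ennreal[OF this radon_outer_regular[OF M, of "B \<inter> K"]] finB[of B]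
        obtain V where V: "open V" "B \<inter> K \<subseteq> V" "emeasure M V < emeasure M (B \<inter> K) + ennreal (e / r)"
          by (auto simp: less_top)
        have "ennreal r * emeasure M V \<le> ennreal r * (emeasure M (B \<inter> K) + ennreal (e / r))"
          using V(3) by (intro mult_left_mono) auto
        also have "\<dots> = emeasure ?N B + ennreal e"
          using r \<open>0 < e\<close> by (simp add: Nem distrib_left ennreal_mult[symmetric])
        finally show "(INF U\<in>{U. open U \<and> B \<subseteq> U}. emeasure ?N U) \<le> emeasure ?N B + ennreal e"
          using le[OF V(1,2)] by (rule order_trans[rotated])
      qed
    qed
  next
    fix U :: "'a set" assume U: "open U"
    show "emeasure ?N U = (SUP L\<in>{L. compact L \<and> L \<subseteq> U}. emeasure ?N L)"
    proof (rule antisym)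
      show "(SUP L\<in>{L. compact L \<and> L \<subseteq> U}. emeasure ?N L) \<le> emeasure ?N U"
        using U by (intro SUP_least emeasure_mono) auto
      have "emeasure ?N U = ennreal r * emeasure M (U \<inter> K)" using U by (simp add: Nem)
      also have "emeasure M (U \<inter> K) = (SUP L\<in>{L. compact L \<and> L \<subseteq> U \<inter> K}. emeasure M L)"
        using U finB by (intro radon_inner_regular[OF M]) auto
      also have "ennreal r * \<dots> = (SUP L\<in>{L. compact L \<and> L \<subseteq> U \<inter> K}. ennreal r * emeasure M L)"
        by (rule SUP_mult_left_ennreal)
      also have "\<dots> \<le> (SUP L\<in>{L. compact L \<and> L \<subseteq> U}. emeasure ?N L)"
      proof (rule SUP_mono)
        fix L assume L: "L \<in> {L. compact L \<and> L \<subseteq> U \<inter> K}"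
        then have "L \<in> sets borel" "L \<inter> K = L" by (auto intro: borel_compact)
        then show "\<exists>m\<in>{L. compact L \<and> L \<subseteq> U}. ennreal r * emeasure M L \<le> emeasure ?N m"
          using L by (intro bexI[of _ L]) (auto simp: Nem)
      qed
      finally show "emeasure ?N U \<le> (SUP L\<in>{L. compact L \<and> L \<subseteq> U}. emeasure ?N L)" .
    qed
  qed
qed


section \<open>Energy and sets of capacity zero\<close>

lemma Cc_continuous: "\<phi> \<in> Cc \<Longrightarrow> continuous_on UNIV \<phi>"
  by (simp add: Cc_def)

lemma CcI:
  fixes \<phi> :: "'a::t2_space \<Rightarrow> real"
  assumes "continuous_on UNIV \<phi>" "compact K" "\<And>x. x \<notin> K \<Longrightarrow> \<phi> x = 0"
  shows "\<phi> \<in> Cc"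
proof -
  have "closure {x. \<phi> x \<noteq> 0} \<subseteq> K"
    using assms(2,3) by (intro closure_minimal compact_imp_closed) auto
  then have "compact (closure {x. \<phi> x \<noteq> 0})"
    using assms(2) compact_Int_closed[OF assms(2) closed_closure, of "{x. \<phi> x \<noteq> 0}"]
    by (simp add: inf.absorb2)
  then show ?thesis using assms(1) by (simp add: Cc_def)
qed

lemma Cc_support:
  assumes "\<phi> \<in> Cc"
  obtains K where "compact K" "\<And>x. x \<notin> K \<Longrightarrow> \<phi> x = 0"
proof (rule that)
  show "compact (closure {x. \<phi> x \<noteq> 0})" using assms by (simp add: Cc_def)
  show "\<phi> x = 0" if "x \<notin> closure {x. \<phi> x \<noteq> 0}" for x
    using that subsetD[OF closure_subset, of x "{x. \<phi> x \<noteq> 0}"] by auto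
qed

lemma Cc_bounded:
  fixes \<phi> :: "'a::t2_space \<Rightarrow> real"
  assumes "\<phi> \<in> Cc"
  obtains B where "0 \<le> B" "\<And>x. \<bar>\<phi> x\<bar> \<le> B"
proof -
  obtain K where K: "compact K" "\<And>x. x \<notin> K \<Longrightarrow> \<phi> x = 0" by (rule Cc_support[OF assms]) blast
  have "compact (\<phi> ` K)"
    using Cc_continuous[OF assms] K(1) by (intro compact_continuous_image) (auto intro: continuous_on_subset)
  then have "bounded (\<phi> ` K)" by (rule compact_imp_bounded)
  then obtain B where "\<And>x. x \<in> K \<Longrightarrow> \<bar>\<phi> x\<bar> \<le> B" by (auto simp: bounded_iff)
  then have "\<bar>\<phi> x\<bar> \<le> max 0 B" for x
    by (cases "x \<in> K") (auto simp: K(2) le_max_iff_disj)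
  then show ?thesis using that[of "max 0 B"] by auto
qed

lemma integrable_Cc:
  fixes \<phi> :: "'a::t2_space \<Rightarrow> real"
  assumes M: "radon_measure M" and phi: "\<phi> \<in> Cc"
  shows "integrable M \<phi>"
proof -
  obtain K where K: "compact K" "\<And>x. x \<notin> K \<Longrightarrow> \<phi> x = 0" by (rule Cc_support[OF phi]) blast
  obtain B where B: "0 \<le> B" "\<And>x. \<bar>\<phi> x\<bar> \<le> B" by (rule Cc_bounded[OF phi]) blast
  have Km: "K \<in> sets M" using K(1) by (simp add: radon_measure_sets[OF M] borel_compact)
  show ?thesis
  proof (rule Bochner_Integration.integrable_bound)
    show "integrable M (\<lambda>x. B * indicator K x)"
      using Km radon_compact_finite[OF M K(1)] by (auto intro!: integrable_real_indicator)
    show "\<phi> \<in> borel_measurable M"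
      using borel_measurable_continuous_onI[OF Cc_continuous[OF phi]]
      by (subst measurable_cong_sets[OF radon_measure_sets[OF M] refl])
    show "AE x in M. norm (\<phi> x) \<le> norm (B * indicator K x)"
      using B K(2) by (auto split: split_indicator)
  qed
qed

lemma Cc_slice:
  fixes \<phi> :: "'a::t2_space \<times> 'b::t2_space \<Rightarrow> real"
  assumes phi: "\<phi> \<in> Cc"
  shows "(\<lambda>y. \<phi> (x, y)) \<in> Cc"
proof -
  obtain K where K: "compact K" "\<And>x. x \<notin> K \<Longrightarrow> \<phi> x = 0" by (rule Cc_support[OF phi]) blast
  have "compact (snd ` K)" using K(1) by (intro compact_continuous_image continuous_intros)
  moreover have "continuous_on UNIV (\<lambda>y. \<phi> (x, y))"
    by (rule continuous_on_compose2[OF Cc_continuous[OF phi]]) (auto intro!: continuous_intros)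
  moreover have "\<phi> (x, y) = 0" if "y \<notin> snd ` K" for y
    using that by (intro K(2)) force
  ultimately show ?thesis by (intro CcI)
qed

text \<open>Makes the iterated integral in \<open>radon_tensor\<close> legitimate. Near
  \<open>x0\<close> the slices are uniformly close along the compact projection \<open>K2\<close>,
  and \<open>K2\<close> has finite measure.\<close>

lemma Cc_integral:
  fixes \<phi> :: "'a::t2_space \<times> 'b::t2_space \<Rightarrow> real"
  assumes M: "radon_measure M" and phi: "\<phi> \<in> Cc"
  shows "(\<lambda>x. \<integral>y. \<phi> (x, y) \<partial>M) \<in> Cc"
proof -
  obtain K where K: "compact K" "\<And>x. x \<notin> K \<Longrightarrow> \<phi> x = 0" by (rule Cc_support[OF phi]) blast
  define K1 where "K1 = fst ` K"
  define K2 where "K2 = snd ` K"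
  have K12: "compact K1" "compact K2"
    unfolding K1_def K2_def using K(1) by (auto intro!: compact_continuous_image continuous_intros)
  have z1: "\<phi> (x, y) = 0" if "x \<notin> K1" for x y using that K(2) by (force simp: K1_def)
  have z2: "\<phi> (x, y) = 0" if "y \<notin> K2" for x y using that K(2) by (force simp: K2_def)
  have K2m: "K2 \<in> sets M" using K12 by (simp add: radon_measure_sets[OF M] borel_compact)
  have K2fin: "emeasure M K2 < \<infinity>" by (rule radon_compact_finite[OF M K12(2)])
  have int: "integrable M (\<lambda>y. \<phi> (x, y))" for x by (rule integrable_Cc[OF M Cc_slice[OF phi]])
  have "continuous_on UNIV (\<lambda>x. \<integral>y. \<phi> (x, y) \<partial>M)"
    unfolding continuous_on_def
  proof (intro ballI tendstoI)
    fix x0 :: 'a and e :: real assume e: "0 < e"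
    \<comment> \<open>The summand 1 keeps the denominator positive when \<open>K2\<close> is a null
      set.\<close>
    define d where "d = e / (measure M K2 + 1)"
    have d: "0 < d" using e by (simp add: d_def add_nonneg_pos)
    obtain X0 where X0: "x0 \<in> X0" "open X0"
      and close: "\<forall>x\<in>X0 \<inter> UNIV. \<forall>t\<in>K2. dist (\<phi> (x, t)) (\<phi> (x0, t)) \<le> d"
      by (rule continuous_on_prod_compactE
          [OF continuous_on_subset[OF Cc_continuous[OF phi] subset_UNIV] K12(2) UNIV_I d])
    have "dist (\<integral>y. \<phi> (x, y) \<partial>M) (\<integral>y. \<phi> (x0, y) \<partial>M) < e" if "x \<in> X0" for x
    proof -
      have "\<bar>(\<integral>y. \<phi> (x, y) - \<phi> (x0, y) \<partial>M)\<bar> \<le> (\<integral>y. d * indicator K2 y \<partial>M)"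
      proof (rule order_trans[OF integral_abs_bound integral_mono])
        show "integrable M (\<lambda>y. \<bar>\<phi> (x, y) - \<phi> (x0, y)\<bar>)" using int by auto
        show "integrable M (\<lambda>y. d * indicator K2 y)"
          using K2m K2fin by (auto intro!: integrable_real_indicator)
        show "\<bar>\<phi> (x, y) - \<phi> (x0, y)\<bar> \<le> d * indicator K2 y" if "y \<in> space M" for y
          using close \<open>x \<in> X0\<close> z2[of y] by (cases "y \<in> K2") (auto simp: dist_real_def)
      qed
      also have "\<dots> = d * measure M K2" using K2m sets.sets_into_space[OF K2m] by (simp add: Int_absorb2)
      also have "\<dots> < d * (measure M K2 + 1)" using d by (intro mult_strict_left_mono) auto
      also have "\<dots> = e" using measure_nonneg[of M K2] by (simp add: d_def add_nonneg_eq_0_iff)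
      finally show ?thesis using int by (simp add: dist_real_def)
    qed
    then show "\<forall>\<^sub>F x in at x0 within UNIV. dist (\<integral>y. \<phi> (x, y) \<partial>M) (\<integral>y. \<phi> (x0, y) \<partial>M) < e"
      using X0 by (auto simp: eventually_at_topological)
  qed
  then show ?thesis
    using K12(1) z1 by (intro CcI[of _ K1]) (auto simp: Bochner_Integration.integral_zero)
qed

section \<open>Tensor products and the energy of a measure cut down to a compact set\<close>

lemma radon_tensor_mono:
  fixes \<phi> \<psi> :: "'a::t2_space \<times> 'a \<Rightarrow> real"
  assumes M: "radon_measure M" "radon_measure N" and phi: "\<phi> \<in> Cc" "\<psi> \<in> Cc"
    and le: "\<And>p. \<phi> p \<le> \<psi> p"
  shows "radon_tensor M N \<phi> \<le> radon_tensor M N \<psi>"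
  unfolding radon_tensor_def
  using M phi le by (intro integral_mono integrable_Cc Cc_integral Cc_slice) auto

lemma radon_tensor_add:
  fixes \<phi> \<psi> :: "'a::t2_space \<times> 'a \<Rightarrow> real"
  assumes M: "radon_measure M" "radon_measure N" and phi: "\<phi> \<in> Cc" "\<psi> \<in> Cc"
  shows "radon_tensor M N (\<lambda>p. \<phi> p + \<psi> p) = radon_tensor M N \<phi> + radon_tensor M N \<psi>"
proof -
  have "(\<integral>y. \<phi> (x, y) + \<psi> (x, y) \<partial>N) = (\<integral>y. \<phi> (x, y) \<partial>N) + (\<integral>y. \<psi> (x, y) \<partial>N)" for x
    by (intro Bochner_Integration.integral_add integrable_Cc Cc_slice M phi)
  then show ?thesis unfolding radon_tensor_def
    by (simp add: Bochner_Integration.integral_add integrable_Cc Cc_integral M phi)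
qed

lemma Cc_add:
  fixes \<phi> \<psi> :: "'a::t2_space \<Rightarrow> real"
  assumes "\<phi> \<in> Cc" "\<psi> \<in> Cc"
  shows "(\<lambda>x. \<phi> x + \<psi> x) \<in> Cc"
proof -
  obtain K where K: "compact K" "\<And>x. x \<notin> K \<Longrightarrow> \<phi> x = 0" by (rule Cc_support[OF assms(1)]) blast
  obtain L where L: "compact L" "\<And>x. x \<notin> L \<Longrightarrow> \<psi> x = 0" by (rule Cc_support[OF assms(2)]) blast
  show ?thesis
    by (rule CcI[OF continuous_on_add[OF assms[THEN Cc_continuous]] compact_Un[OF K(1) L(1)]])
      (simp add: K(2) L(2))
qed

lemma Cc_max:
  fixes \<phi> \<psi> :: "'a::t2_space \<Rightarrow> real"
  assumes "\<phi> \<in> Cc" "\<psi> \<in> Cc"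
  shows "(\<lambda>x. max (\<phi> x) (\<psi> x)) \<in> Cc"
proof -
  obtain K where K: "compact K" "\<And>x. x \<notin> K \<Longrightarrow> \<phi> x = 0" by (rule Cc_support[OF assms(1)]) blast
  obtain L where L: "compact L" "\<And>x. x \<notin> L \<Longrightarrow> \<psi> x = 0" by (rule Cc_support[OF assms(2)]) blast
  show ?thesis
    by (rule CcI[OF continuous_on_max[OF assms[THEN Cc_continuous]] compact_Un[OF K(1) L(1)]])
      (simp add: K(2) L(2))
qed

lemma Cc_uminus:
  fixes \<phi> :: "'a::t2_space \<Rightarrow> real"
  assumes "\<phi> \<in> Cc"
  shows "(\<lambda>x. - \<phi> x) \<in> Cc"
proof -
  obtain K where K: "compact K" "\<And>x. x \<notin> K \<Longrightarrow> \<phi> x = 0" by (rule Cc_support[OF assms(1)]) blast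
  show ?thesis
    by (rule CcI[OF continuous_on_minus[OF Cc_continuous[OF assms]] K(1)]) (simp add: K(2))
qed

text \<open>For a nonnegative integrand, dropping the indicator of \<open>K\<close> can only
  increase the integral. Each of the two integrations contributes one factor
  \<open>r\<close>.\<close>

lemma radon_tensor_density_compact:
  fixes \<phi> :: "'a::t2_space \<times> 'a \<Rightarrow> real"
  assumes M: "radon_measure M" and K: "compact K" and r: "0 < r" and phi: "\<phi> \<in> Cc" and nn: "\<And>p. 0 \<le> \<phi> p"
  defines "N \<equiv> density M (\<lambda>x. ennreal (r * indicator K x))"
  shows "radon_tensor N N \<phi> \<le> r\<^sup>2 * radon_tensor M M \<phi>"
proof -
  have N: "radon_measure N" unfolding N_def by (rule radon_density_compact[OF M K r])
  have int_le: "(\<integral>x. \<psi> x \<partial>N) \<le> r * (\<integral>x. \<psi> x \<partial>M)" if psi: "\<psi> \<in> Cc" "\<And>x. 0 \<le> \<psi> x" for \<psi> :: "'a \<Rightarrow> real"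
  proof -
    have meas: "(\<lambda>x. r * indicator K x) \<in> borel_measurable M"
      using borel_compact[OF K]
      by (subst measurable_cong_sets[OF radon_measure_sets[OF M] refl])
        (intro borel_measurable_times borel_measurable_const borel_measurable_indicator)
    have i: "integrable M \<psi>" by (rule integrable_Cc[OF M psi(1)])
    have "(\<integral>x. \<psi> x \<partial>N) = (\<integral>x. (r * indicator K x) *\<^sub>R \<psi> x \<partial>M)"
      unfolding N_def using i r by (intro integral_density meas) auto
    also have "\<dots> \<le> (\<integral>x. r * \<psi> x \<partial>M)"
      using i r psi(2) by (intro integral_mono' integrable_mult_right) (auto split: split_indicator)
    finally show ?thesis by simp
  qed
  let ?I = "\<lambda>x. \<integral>y. \<phi> (x, y) \<partial>M"
  have "radon_tensor N N \<phi> \<le> (\<integral>x. r * ?I x \<partial>N)"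
    unfolding radon_tensor_def
    using nn by (intro integral_mono integrable_mult_right integrable_Cc[OF N] Cc_integral M N phi int_le Cc_slice) auto
  also have "\<dots> = r * (\<integral>x. ?I x \<partial>N)" by simp
  also have "\<dots> \<le> r * (r * (\<integral>x. ?I x \<partial>M))"
    using r nn by (intro mult_left_mono int_le Cc_integral M phi integral_nonneg) auto
  finally show ?thesis by (simp add: radon_tensor_def power2_eq_square)
qed

text \<open>A kernel that is negative somewhere lives on a compact space, where a lower
  semicontinuous function without the value -\<infinity> is bounded below. In either case the
  constant is itself a test function, so it may be added to test functions later.\<close>

lemma kernel_lower_bound:
  fixes \<kappa> :: "'a::t2_space \<times> 'a \<Rightarrow> ereal"
  assumes "kernel \<kappa>"
  obtains c :: real where "0 \<le> c" "\<And>p. ereal (- c) \<le> \<kappa> p" "(\<lambda>p::'a \<times> 'a. c) \<in> Cc"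
proof (cases "\<forall>p. 0 \<le> \<kappa> p")
  case True
  have "(\<lambda>p::'a \<times> 'a. 0::real) \<in> Cc" by (rule CcI[of _ "{}"]) auto
  then show ?thesis using that[of 0] True by (auto simp: zero_ereal_def)
next
  case False
  then have cpt: "compact (UNIV :: ('a \<times> 'a) set)"
    and lsc: "\<And>t. open {p. t < \<kappa> p}" and fin: "\<And>p. \<kappa> p \<noteq> -\<infinity>"
    using assms by (auto simp: kernel_def Psi_class_def)
  define U where "U n = {p. ereal (- real n) < \<kappa> p}" for n :: nat
  have "\<exists>n. p \<in> U n" for p
  proof (cases "\<kappa> p")
    case (real r)
    obtain n :: nat where "- r < n" using reals_Archimedean2 by blast
    then show ?thesis using real by (intro exI[of _ n]) (auto simp: U_def)
  qed (use fin[of p] in \<open>auto simp: U_def\<close>)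
  then have "UNIV \<subseteq> (\<Union>n\<in>UNIV. U n)" by auto
  then obtain F where F: "finite F" "UNIV \<subseteq> (\<Union>n\<in>F. U n)"
    using compactE_image[OF cpt, of UNIV U] lsc by (auto simp: U_def)
  define c where "c = real (Max (insert 0 F))"
  have "ereal (- c) \<le> \<kappa> p" for p
  proof -
    obtain n where n: "n \<in> F" "ereal (- real n) < \<kappa> p" using F(2) by (auto simp: U_def)
    have "n \<le> Max (insert 0 F)" using F(1) n(1) by auto
    then have "ereal (- c) \<le> ereal (- real n)" by (auto simp: c_def)
    then show ?thesis using n(2) by (metis less_imp_le order_trans)
  qed
  moreover have "(\<lambda>p::'a \<times> 'a. c) \<in> Cc" by (rule CcI[OF _ cpt]) auto
  ultimately show ?thesis using that[of c] by (auto simp: c_def)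
qed

text \<open>Test functions below the kernel may be negative, and then cutting off to
  \<open>K\<close> need not decrease the integral. Adding the lower bound \<open>c\<close> makes
  them nonnegative; its own tensor integral is finite and goes into the bound
  \<open>b\<close>.\<close>

lemma mutual_energy_density_compact:
  fixes \<kappa> :: "'a::t2_space \<times> 'a \<Rightarrow> ereal"
  assumes ker: "kernel \<kappa>" and M: "radon_measure M" and K: "compact K" and r: "0 < r"
    and fin: "mutual_energy \<kappa> M M \<noteq> \<infinity>"
  shows "\<exists>b::real. mutual_energy \<kappa> (density M (\<lambda>x. ennreal (r * indicator K x)))
           (density M (\<lambda>x. ennreal (r * indicator K x))) \<le> ereal b"
proof -
  let ?N = "density M (\<lambda>x. ennreal (r * indicator K x))"
  have N: "radon_measure ?N" by (rule radon_density_compact[OF M K r])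
  obtain c :: real where c: "0 \<le> c" "\<And>p. ereal (- c) \<le> \<kappa> p" "(\<lambda>p::'a \<times> 'a. c) \<in> Cc"
    by (rule kernel_lower_bound[OF ker]) blast
  obtain m :: real where m: "mutual_energy \<kappa> M M \<le> ereal m"
    using fin by (cases "mutual_energy \<kappa> M M") auto
  define b where "b = r\<^sup>2 * (m + radon_tensor M M (\<lambda>_. c))"
  have "radon_tensor ?N ?N \<phi> \<le> b" if phi: "\<phi> \<in> Cc" "\<And>p. ereal (\<phi> p) \<le> \<kappa> p" for \<phi>
  proof -
    \<comment> \<open>The maximum with \<open>- c\<close> is still below the kernel, hence still a
      competitor for the energy of \<open>M\<close>, while \<psi> + c is nonnegative and dominates
      \<phi>.\<close>
    define \<psi> where "\<psi> = (\<lambda>p. max (\<phi> p) (- c))"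
    have psi: "\<psi> \<in> Cc" unfolding \<psi>_def by (intro Cc_max phi Cc_uminus c)
    have psi_le: "ereal (\<psi> p) \<le> \<kappa> p" for p using phi(2)[of p] c(2)[of p] by (auto simp: \<psi>_def max_def)
    have h: "(\<lambda>p. \<psi> p + c) \<in> Cc" "\<And>p. 0 \<le> \<psi> p + c" using Cc_add[OF psi c(3)] by (auto simp: \<psi>_def)
    have "radon_tensor ?N ?N \<phi> \<le> radon_tensor ?N ?N (\<lambda>p. \<psi> p + c)"
      using c(1) by (intro radon_tensor_mono N phi h) (auto simp: \<psi>_def)
    also have "\<dots> \<le> r\<^sup>2 * radon_tensor M M (\<lambda>p. \<psi> p + c)"
      by (rule radon_tensor_density_compact[OF M K r h])
    also have "\<dots> = r\<^sup>2 * (radon_tensor M M \<psi> + radon_tensor M M (\<lambda>_. c))"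
      by (simp add: radon_tensor_add[OF M M psi c(3)])
    also have "\<dots> \<le> b"
    proof -
      have "ereal (radon_tensor M M \<psi>) \<le> mutual_energy \<kappa> M M"
        unfolding mutual_energy_def using psi psi_le by (intro SUP_upper) auto
      then have "ereal (radon_tensor M M \<psi>) \<le> ereal m" using m by (rule order_trans)
      then show ?thesis by (auto simp: b_def intro!: mult_left_mono)
    qed
    finally show ?thesis .
  qed
  then show ?thesis unfolding mutual_energy_def by (intro exI[of _ b] SUP_least) auto
qed

section \<open>Nonnegativity of the energy and negligibility of sets of capacity zero\<close>

lemma radon_measure_null: "radon_measure (null_measure (borel :: 'a::t2_space measure))"
proof -
  have "(INF U\<in>{U. open U \<and> B \<subseteq> U}. 0::ennreal) = 0" for B :: "'a set"
    by (rule INF_eq_const) (auto intro!: exI[of _ UNIV])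
  moreover have "(SUP K\<in>{K. compact K \<and> K \<subseteq> U}. 0::ennreal) = 0" for U :: "'a set"
    by (rule SUP_eq_const) (auto intro!: exI[of _ "{}"])
  ultimately show ?thesis by (simp add: radon_measure_def)
qed

lemma mutual_energy_null:
  fixes \<kappa> :: "'a::t2_space \<times> 'a \<Rightarrow> ereal"
  assumes "kernel \<kappa>"
  shows "mutual_energy \<kappa> (null_measure borel) (null_measure borel) = 0" "mutual_energy \<kappa> M (null_measure borel) = 0"
proof -
  obtain c :: real where c: "0 \<le> c" "\<And>p. ereal (- c) \<le> \<kappa> p" "(\<lambda>p::'a \<times> 'a. c) \<in> Cc"
    by (rule kernel_lower_bound[OF assms]) blast
  \<comment> \<open>Over an empty set of test functions the supremum would be -\<infinity> instead
    of 0; the constant \<open>- c\<close> is a member.\<close>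
  have ne: "{\<phi> \<in> Cc. \<forall>p. ereal (\<phi> p) \<le> \<kappa> p} \<noteq> {}" (is "?S \<noteq> {}")
  proof -
    have "(\<lambda>p::'a \<times> 'a. - c) \<in> ?S" using Cc_uminus[OF c(3)] c(2) by simp
    then show ?thesis by (metis empty_iff)
  qed
  have 0: "(\<integral>y. h y \<partial>null_measure borel) = 0" for h :: "'a \<Rightarrow> real"
  proof -
    have "AE y in null_measure borel. h y = 0"
      by (rule AE_I[of _ _ UNIV]) auto
    then show ?thesis by (rule integral_eq_zero_AE)
  qed
  have "radon_tensor (null_measure borel) (null_measure borel) \<phi> = 0"
    "radon_tensor M (null_measure borel) \<phi> = 0" for \<phi> :: "'a \<times> 'a \<Rightarrow> real"
    by (simp_all add: radon_tensor_def 0)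
  then show "mutual_energy \<kappa> (null_measure borel) (null_measure borel) = 0" "mutual_energy \<kappa> M (null_measure borel) = 0"
    unfolding mutual_energy_def by (simp_all only: cSUP_const[OF ne] zero_ereal_def)
qed

text \<open>Positive definiteness is applied to \<open>M\<close> with zero negative part. The mutual
  energy with the null measure is 0, so the proviso that the energy be defined holds even if
  \<open>M\<close> has infinite energy.\<close>

lemma mutual_energy_nonneg:
  fixes \<kappa> :: "'a::t2_space \<times> 'a \<Rightarrow> ereal"
  assumes pd: "positive_definite_kernel \<kappa>" and M: "radon_measure M"
  shows "0 \<le> mutual_energy \<kappa> M M"
proof -
  have ker: "kernel \<kappa>" using pd by (simp add: positive_definite_kernel_def)
  have "radon_disjoint M (null_measure borel)"
    unfolding radon_disjoint_def
  proof (intro allI impI, elim conjE)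
    fix \<rho> :: "'a measure" assume r: "radon_measure \<rho>" "\<rho> \<le> null_measure borel"
    then have "emeasure \<rho> \<le> emeasure (null_measure borel)"
      using radon_measure_sets[OF r(1)] radon_measure_space[OF r(1)] by (simp add: le_measure_iff)
    then have "emeasure \<rho> UNIV \<le> emeasure (null_measure borel) (UNIV :: 'a set)"
      by (simp add: le_fun_def)
    then show "emeasure \<rho> UNIV = 0" by simp
  qed
  then show ?thesis
    using pd M radon_measure_null mutual_energy_null[OF ker]
    unfolding positive_definite_kernel_def by fastforce
qed

text \<open>A compact part of positive measure would, once normalised, be a competitor of finite energy
  in the definition of the capacity.\<close>

lemma capacity_zero_imp_null:
  fixes \<kappa> :: "'a::t2_space \<times> 'a \<Rightarrow> ereal"
  assumes pd: "positive_definite_kernel \<kappa>" and M: "radon_measure M" and fin: "mutual_energy \<kappa> M M \<noteq> \<infinity>"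
    and Q: "Q \<in> sets borel" "emeasure M Q < \<infinity>" and R: "Q \<subseteq> R" and cap: "inner_capacity \<kappa> R = 0"
  shows "emeasure M Q = 0"
proof (rule ccontr)
  assume "emeasure M Q \<noteq> 0"
  then obtain K where K: "compact K" "K \<subseteq> Q" "0 < emeasure M K"
    using radon_positive_compact[OF M Q] by blast
  note [simp] = radon_measure_sets[OF M] radon_measure_space[OF M]
  have Kb: "K \<in> sets borel" using K(1) by (rule borel_compact)
  have ker: "kernel \<kappa>" using pd by (simp add: positive_definite_kernel_def)
  have Kem: "emeasure M K = ennreal (measure M K)"
    using radon_compact_finite[OF M K(1)] by (intro emeasure_eq_ennreal_measure) auto
  define r where "r = 1 / measure M K"
  have mpos: "0 < measure M K" using K(3) Kem by simp
  then have r: "0 < r" by (simp add: r_def)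
  let ?N = "density M (\<lambda>x. ennreal (r * indicator K x))"
  have N: "radon_measure ?N" by (rule radon_density_compact[OF M K(1) r])
  have meas: "(\<lambda>x. ennreal (r * indicator K x)) \<in> borel_measurable M"
    using Kb
    by (subst measurable_cong_sets[OF radon_measure_sets[OF M] refl])
      (intro measurable_compose[OF _ measurable_ennreal] borel_measurable_times borel_measurable_const
        borel_measurable_indicator)
  have Nem: "emeasure ?N B = ennreal r * emeasure M (B \<inter> K)" if B: "B \<in> sets borel" for B
  proof -
    have "emeasure ?N B = (\<integral>\<^sup>+x. ennreal (r * indicator K x) * indicator B x \<partial>M)"
      by (rule emeasure_density[OF meas]) (simp add: B)
    also have "\<dots> = (\<integral>\<^sup>+x. ennreal r * indicator (B \<inter> K) x \<partial>M)"
      by (intro nn_integral_cong) (auto split: split_indicator)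
    finally show ?thesis using B Kb by (simp add: nn_integral_cmult_indicator)
  qed
  have "emeasure ?N K = ennreal r * emeasure M K"
    using Nem[OF Kb] by simp
  also have "\<dots> = 1" using mpos r by (simp add: Kem r_def flip: ennreal_mult)
  finally have NK: "emeasure ?N K = 1" .
  have "- K \<in> sets borel" using Kb by auto
  then have null: "- K \<in> null_sets ?N" by (intro null_setsI) (simp_all add: Nem)
  have sub: "B \<in> null_sets (completion ?N)" if "B \<subseteq> - K" for B
    using null that by (rule null_sets_completion_subset[OF _ null_sets_completionI, rotated])
  have KR: "K \<subseteq> R" using K(2) R by auto
  \<comment> \<open>\<open>R\<close> is arbitrary and may fail to be Borel; it is measurable for the
    completion because \<open>?N\<close> lives on \<open>K\<close> alone.\<close>
  have "emeasure (completion ?N) (K \<union> (R - K)) = emeasure (completion ?N) K"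
    using Kb by (intro emeasure_Un_null_set sub) auto
  also have "\<dots> = 1" using NK Kb by simp
  finally have NR: "emeasure (completion ?N) R = 1"
    using KR by (simp add: Un_absorb1)
  have "- R \<inter> L \<in> null_sets (completion ?N)" if "compact L" for L
    using KR by (intro sub) auto
  then have "?N \<in> radon_carried R"
    using N by (auto simp: radon_carried_def locally_negligible_def)
  moreover obtain b where b: "mutual_energy \<kappa> ?N ?N \<le> ereal b"
    using mutual_energy_density_compact[OF ker M K(1) r fin] by blast
  moreover have "0 \<le> mutual_energy \<kappa> ?N ?N" by (rule mutual_energy_nonneg[OF pd N])
  ultimately have mem: "?N \<in> {\<nu> \<in> finite_energy_pos \<kappa> R. emeasure (completion \<nu>) R = 1}"
    using NR by (auto simp: finite_energy_pos_def)
  let ?I = "INF \<nu>\<in>{\<nu> \<in> finite_energy_pos \<kappa> R. emeasure (completion \<nu>) R = 1}. mutual_energy \<kappa> \<nu> \<nu>"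
  have "?I \<le> ereal b" by (rule INF_lower2[OF mem]) (rule b)
  \<comment> \<open>On \<open>ereal\<close> the inverse vanishes exactly at the two infinities; the
    bounds 0 and \<open>b\<close> exclude both.\<close>
  moreover have "0 \<le> ?I"
    by (intro INF_greatest mutual_energy_nonneg[OF pd])
      (auto simp: finite_energy_pos_def radon_carried_def)
  ultimately show False using cap unfolding inner_capacity_def by (cases ?I) (auto split: if_splits)
qed

text \<open>Without competitors the infimum is \<infinity>, whose inverse is 0.\<close>

lemma capacity_zeroI:
  assumes "\<And>\<nu>. radon_measure \<nu> \<Longrightarrow> mutual_energy \<kappa> \<nu> \<nu> \<noteq> \<infinity> \<Longrightarrow> emeasure (completion \<nu>) Q = 1 \<Longrightarrow> False"
  shows "inner_capacity \<kappa> Q = 0"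
proof -
  have empty: "{\<nu> \<in> finite_energy_pos \<kappa> Q. emeasure (completion \<nu>) Q = 1} = {}"
    using assms unfolding finite_energy_pos_def radon_carried_def by force
  show ?thesis unfolding inner_capacity_def empty by (simp add: top_ereal_def)
qed


section \<open>Lower semicontinuity on a subset\<close>

text \<open>Relative to \<open>S\<close>, since signs and bounds of the potentials are controlled
  only on the closed sets attached to the plates. The codomain is any linear order, so that
  \<open>ereal\<close> and \<open>ennreal\<close> are treated alike.\<close>

definition lsc_on :: "'a::topological_space set \<Rightarrow> ('a \<Rightarrow> 'b::linorder) \<Rightarrow> bool" where
  "lsc_on S F \<longleftrightarrow> (\<forall>x\<in>S. \<forall>t<F x. \<forall>\<^sub>F y in at x within S. t < F y)"

lemma lsc_on_open:
  assumes "lsc_on S F"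
  obtains U where "open U" "{x\<in>S. t < F x} = S \<inter> U"
proof
  let ?U = "\<Union>{U. open U \<and> (\<forall>y\<in>S \<inter> U. t < F y)}"
  show "open ?U" by auto
  show "{x\<in>S. t < F x} = S \<inter> ?U"
  proof (intro equalityI subsetI)
    fix x assume x: "x \<in> {x\<in>S. t < F x}"
    then have "\<forall>\<^sub>F y in at x within S. t < F y" using assms by (auto simp: lsc_on_def)
    then obtain U where U: "open U" "x \<in> U" "\<And>y. y \<in> U \<Longrightarrow> y \<noteq> x \<Longrightarrow> y \<in> S \<Longrightarrow> t < F y"
      unfolding eventually_at_topological by metis
    \<comment> \<open>The punctured filter says nothing at \<open>x\<close> itself, where the
      inequality is the assumption.\<close>
    then have "\<forall>y\<in>S \<inter> U. t < F y" using x by (metis IntE mem_Collect_eq)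
    then show "x \<in> S \<inter> ?U" using x U by auto
  qed auto
qed

lemma lsc_onI_open:
  assumes "\<And>t. open {x. t < F x}"
  shows "lsc_on S F"
  unfolding lsc_on_def
proof (intro ballI allI impI)
  fix x t assume "x \<in> S" "t < F x"
  then show "\<forall>\<^sub>F y in at x within S. t < F y"
    using assms[of t] unfolding eventually_at_topological by auto
qed

lemma lsc_on_continuous:
  fixes F :: "'a::topological_space \<Rightarrow> 'b::linorder_topology"
  assumes "continuous_on S F"
  shows "lsc_on S F"
  using assms by (auto simp: lsc_on_def continuous_on_def intro: order_tendstoD)

lemma lsc_on_cong: "(\<And>x. x \<in> S \<Longrightarrow> F x = G x) \<Longrightarrow> lsc_on S F \<longleftrightarrow> lsc_on S G"
  unfolding lsc_on_def
  by (intro ball_cong refl all_cong imp_cong) (auto simp: eventually_at_filter intro!: eventually_subst)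

lemma lsc_on_SUP:
  fixes F :: "'i \<Rightarrow> 'a::topological_space \<Rightarrow> 'b::complete_linorder"
  assumes "\<And>i. i \<in> I \<Longrightarrow> lsc_on S (F i)"
  shows "lsc_on S (\<lambda>x. SUP i\<in>I. F i x)"
  unfolding lsc_on_def
proof (intro ballI allI impI)
  fix x t assume "x \<in> S" "t < (SUP i\<in>I. F i x)"
  then obtain i where i: "i \<in> I" "t < F i x" by (auto simp: less_SUP_iff)
  then have "\<forall>\<^sub>F y in at x within S. t < F i y" using assms \<open>x \<in> S\<close> by (auto simp: lsc_on_def)
  then show "\<forall>\<^sub>F y in at x within S. t < (SUP i\<in>I. F i y)"
    by eventually_elim (use i in \<open>auto simp: less_SUP_iff\<close>)
qed

text \<open>Splits a strict lower bound of a sum between the summands. An infinite summand absorbs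
  any deficit; if both are finite, each gives up one third of the gap, which leaves one third to
  spare.\<close>

lemma ereal_less_add:
  fixes x y t :: ereal
  assumes "t < x + y" "x \<noteq> -\<infinity>" "y \<noteq> -\<infinity>"
  obtains a b :: real where "ereal a < x" "ereal b < y" "t < ereal (a + b)"
proof -
  have "\<exists>a b :: real. ereal a < x \<and> ereal b < y \<and> ereal u < ereal (a + b)" if u: "ereal u < x + y" for u :: real
  proof -
    have ex_less: "\<exists>b::real. ereal b < z" if "z \<noteq> -\<infinity>" for z
      using that ereal_dense2[of "-\<infinity>" z] by (auto simp: ereal_less_eq)
    obtain a0 b0 :: real where ab: "ereal a0 < x" "ereal b0 < y" using ex_less assms(2,3) by blast
    show ?thesis
    proof (cases "x = \<infinity>")
      case True
      then show ?thesis using ab by (intro exI[of _ "u - b0 + 1"] exI[of _ b0]) auto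
    next
      case False
      then obtain x' where x': "x = ereal x'" using assms(2) by (cases x) auto
      show ?thesis
      proof (cases "y = \<infinity>")
        case True
        then show ?thesis using ab by (intro exI[of _ a0] exI[of _ "u - a0 + 1"]) auto
      next
        case False
        then obtain y' where y': "y = ereal y'" using assms(3) by (cases y) auto
        define e where "e = (x' + y' - u) / 3"
        have "0 < e" using u by (simp add: x' y' e_def)
        moreover have "x' + y' = u + 3 * e" unfolding e_def by (simp add: field_simps)
        ultimately have "x' - e < x'" "y' - e < y'" "u < (x' - e) + (y' - e)" by linarith+
        then show ?thesis
          by (intro exI[of _ "x' - e"] exI[of _ "y' - e"]) (simp add: x' y')
      qed
    qed
  qed
  moreover obtain u :: real where "t < ereal u" "ereal u < x + y"
    using ereal_dense2[OF assms(1)] by auto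
  ultimately show ?thesis using that by (meson less_trans)
qed

lemma lsc_on_add_ereal:
  fixes F G :: "'a::topological_space \<Rightarrow> ereal"
  assumes "lsc_on S F" "lsc_on S G" "\<And>x. x \<in> S \<Longrightarrow> F x \<noteq> -\<infinity>" "\<And>x. x \<in> S \<Longrightarrow> G x \<noteq> -\<infinity>"
  shows "lsc_on S (\<lambda>x. F x + G x)"
  unfolding lsc_on_def
proof (intro ballI allI impI)
  fix x t assume x: "x \<in> S" and t: "t < F x + G x"
  obtain a b :: real where ab: "ereal a < F x" "ereal b < G x" "t < ereal (a + b)"
    using ereal_less_add[OF t assms(3,4)[OF x]] by blast
  have "\<forall>\<^sub>F y in at x within S. ereal a < F y" "\<forall>\<^sub>F y in at x within S. ereal b < G y"
    using assms(1,2) x ab by (auto simp: lsc_on_def)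
  then show "\<forall>\<^sub>F y in at x within S. t < F y + G y"
  proof eventually_elim
    case (elim y)
    then have "ereal a + ereal b \<le> F y + G y" by (intro add_mono less_imp_le)
    then show ?case using ab(3) by (simp add: less_le_trans)
  qed
qed

lemma enn2ereal_neq_MInf: "enn2ereal v \<noteq> -\<infinity>"
  using enn2ereal_nonneg[of v] by auto

text \<open>Truncation at 0 leaves superlevel sets with nonnegative level unchanged, and this is how
  semicontinuity passes from \<open>ereal\<close> to \<open>ennreal\<close>.\<close>

lemma less_e2ennreal_iff: "t < e2ennreal v \<longleftrightarrow> enn2ereal t < v"
proof (cases "0 \<le> v")
  case True
  then show ?thesis by (simp add: less_ennreal.rep_eq enn2ereal_e2ennreal)
next
  case False
  then have "v \<le> 0" by simp
  moreover have "\<not> enn2ereal t < v" using False enn2ereal_nonneg[of t] by (metis less_imp_le order_trans)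
  ultimately show ?thesis by (simp add: e2ennreal_neg)
qed

lemma lsc_on_e2ennreal: "lsc_on S F \<Longrightarrow> lsc_on S (\<lambda>x. e2ennreal (F x))"
  by (simp add: lsc_on_def less_e2ennreal_iff)

lemma lsc_on_enn2ereal:
  assumes "lsc_on S F"
  shows "lsc_on S (\<lambda>x. enn2ereal (F x))"
  unfolding lsc_on_def
proof (intro ballI allI impI)
  fix x t assume x: "x \<in> S" and t: "t < enn2ereal (F x)"
  show "\<forall>\<^sub>F y in at x within S. t < enn2ereal (F y)"
  proof (cases "0 \<le> t")
    case True
    then have *: "t < enn2ereal v \<longleftrightarrow> e2ennreal t < v" for v
      by (simp add: less_ennreal.rep_eq enn2ereal_e2ennreal)
    then show ?thesis using assms x t by (simp add: lsc_on_def)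
  next
    case False
    then show ?thesis by (intro always_eventually) (metis enn2ereal_nonneg not_le_imp_less less_le_trans)
  qed
qed

lemma lsc_on_add_ennreal:
  fixes F G :: "'a::topological_space \<Rightarrow> ennreal"
  assumes "lsc_on S F" "lsc_on S G"
  shows "lsc_on S (\<lambda>x. F x + G x)"
proof -
  have "lsc_on S (\<lambda>x. e2ennreal (enn2ereal (F x) + enn2ereal (G x)))"
    by (intro lsc_on_e2ennreal lsc_on_add_ereal lsc_on_enn2ereal assms enn2ereal_neq_MInf)
  then show ?thesis by (simp flip: plus_ennreal.rep_eq)
qed

lemma lsc_on_sum_ennreal:
  fixes F :: "'i \<Rightarrow> 'a::topological_space \<Rightarrow> ennreal"
  assumes "\<And>i. i \<in> I \<Longrightarrow> lsc_on S (F i)"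
  shows "lsc_on S (\<lambda>x. \<Sum>i\<in>I. F i x)"
  using assms
proof (induction I rule: infinite_finite_induct)
  case (insert i I)
  then show ?case by (simp add: lsc_on_add_ennreal)
qed (auto simp: lsc_on_def)

text \<open>A series of nonnegative terms is the supremum of its finite partial sums, so no
  uniformity in the index is required.\<close>

lemma lsc_on_infsum_ennreal:
  fixes F :: "'i \<Rightarrow> 'a::topological_space \<Rightarrow> ennreal"
  assumes "\<And>i. i \<in> I \<Longrightarrow> lsc_on S (F i)"
  shows "lsc_on S (\<lambda>x. \<Sum>\<^sub>\<infinity>i\<in>I. F i x)"
proof -
  have "lsc_on S (\<lambda>x. SUP J\<in>{J. finite J \<and> J \<subseteq> I}. sum (\<lambda>i. F i x) J)"
    using assms by (intro lsc_on_SUP lsc_on_sum_ennreal) auto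
  then show ?thesis by (simp add: nonneg_infsum_complete)
qed

lemma lsc_on_measurable:
  fixes F :: "'a::topological_space \<Rightarrow> ereal"
  assumes "lsc_on S F" "S \<in> sets borel"
  shows "F \<in> borel_measurable (restrict_space borel S)"
proof (rule borel_measurableI_greater)
  fix t
  obtain U where U: "open U" "{x\<in>S. t < F x} = S \<inter> U" by (rule lsc_on_open[OF assms(1)])
  then have "{x \<in> space (restrict_space borel S). t < F x} = S \<inter> U" by (auto simp: space_restrict_space)
  then show "{x \<in> space (restrict_space borel S). t < F x} \<in> sets (restrict_space borel S)"
    using U(1) by (auto simp: sets_restrict_space)
qed

section \<open>Semicontinuity of integrals depending on a parameter\<close>

lemma ennreal_less_sum_approx:
  fixes a :: "'i \<Rightarrow> ennreal"
  assumes "finite I" "t < sum a I"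
  shows "\<exists>b. t < sum b I \<and> (\<forall>i\<in>I. b i = 0 \<or> b i < a i)"
  using assms
proof (induction I arbitrary: t rule: finite_induct)
  case (insert i I)
  have "\<exists>u v. t < u + v \<and> (u = 0 \<or> u < a i) \<and> (v = 0 \<or> v < sum a I)"
  proof -
    have "enn2ereal t < enn2ereal (a i) + enn2ereal (sum a I)"
      using insert by (simp add: less_ennreal.rep_eq plus_ennreal.rep_eq)
    then obtain c d :: real where cd: "ereal c < enn2ereal (a i)" "ereal d < enn2ereal (sum a I)"
      "enn2ereal t < ereal (c + d)"
      using ereal_less_add[OF _ enn2ereal_neq_MInf enn2ereal_neq_MInf] by blast
    have "ennreal c = 0 \<or> ennreal c < a i" "ennreal d = 0 \<or> ennreal d < sum a I"
      using cd(1,2) by (cases "0 \<le> c"; cases "0 \<le> d"; simp add: less_ennreal.rep_eq ennreal_neg)+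
    moreover have "t < ennreal c + ennreal d"
    proof -
      have "enn2ereal t < enn2ereal (ennreal c) + enn2ereal (ennreal d)"
      proof (rule less_le_trans[OF cd(3)])
        have le: "ereal z \<le> enn2ereal (ennreal z)" for z
          by (cases "0 \<le> z") (auto simp: ennreal_neg zero_ennreal.rep_eq)
        show "ereal (c + d) \<le> enn2ereal (ennreal c) + enn2ereal (ennreal d)"
          using add_mono[OF le[of c] le[of d]] by simp
      qed
      then show ?thesis by (simp add: less_ennreal.rep_eq plus_ennreal.rep_eq)
    qed
    ultimately show ?thesis by blast
  qed
  then obtain u v where uv: "t < u + v" "u = 0 \<or> u < a i" "v = 0 \<or> v < sum a I" by blast
  obtain b where b: "v \<le> sum b I" "\<forall>i\<in>I. b i = 0 \<or> b i < a i"
  proof (cases "v = 0")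
    case True
    then show ?thesis using that[of "\<lambda>_. 0"] by auto
  next
    case False
    then show ?thesis using insert.IH[of v] uv(3) that by (auto intro: less_imp_le)
  qed
  have "sum (b(i := u)) (insert i I) = u + sum b I"
    using insert.hyps by (auto intro!: arg_cong2[where f="(+)"] sum.cong)
  moreover have "t < u + sum b I" using uv(1) b(1) by (meson add_left_mono less_le_trans)
  ultimately show ?case using b(2) uv(2) by (intro exI[of _ "b(i := u)"]) auto
qed auto

lemma ennreal_less_mult_approx:
  fixes b c m :: ennreal
  assumes "b < c * m" "c < top" "m < top"
  obtains d where "d < c" "b < d * m"
proof -
  obtain c' where c': "c = ennreal c'" "0 \<le> c'" using assms(2) by (cases c) auto
  obtain m' where m': "m = ennreal m'" "0 \<le> m'" using assms(3) by (cases m) auto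
  have "b < top" using assms(1) by (rule less_trans) (simp add: c' m' flip: ennreal_mult)
  then obtain b' where b': "b = ennreal b'" "0 \<le> b'" by (cases b) auto
  have lt: "b' < c' * m'" using assms(1) c' m' b' by (simp flip: ennreal_mult add: ennreal_less_iff)
  then have m0: "0 < m'" using b' m' c' by (metis less_eq_real_def mult_zero_right not_less)
  have "b' / m' < c'" using lt m0 by (simp add: field_simps)
  then obtain d where d: "b' / m' < d" "d < c'" using dense by blast
  moreover have "0 \<le> d" using d(1) b' m0 by (meson divide_nonneg_pos less_imp_le order_trans)
  moreover have "b' < d * m'" using d(1) m0 by (simp add: field_simps)
  ultimately show ?thesis
    using that[of "ennreal d"] c' m' b' by (simp add: ennreal_less_iff flip: ennreal_mult)
qed

text \<open>Below the integrand at \<open>x0\<close> lies a simple function whose integral still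
  exceeds \<open>t\<close>. Each of its level sets is approximated from inside by a compact
  \<open>K\<close>, and by the tube lemma a slightly smaller value \<open>d\<close> remains a lower
  bound on all of \<open>K\<close> for nearby \<open>x\<close>. Restricting to \<open>T\<close> is
  harmless because its complement is null.\<close>

lemma lsc_on_nn_integral:
  fixes h :: "'b::topological_space \<times> 'a::t2_space \<Rightarrow> ennreal"
  assumes M: "radon_measure M" and fin: "emeasure M UNIV < \<infinity>"
    and T: "T \<in> sets borel" and null: "emeasure M (- T) = 0" and h: "lsc_on (S \<times> T) h"
  shows "lsc_on S (\<lambda>x. \<integral>\<^sup>+y. h (x, y) \<partial>M)"
  unfolding lsc_on_def
proof (intro ballI allI impI)
  note [simp] = radon_measure_sets[OF M] radon_measure_space[OF M]
  fix x0 t assume x0: "x0 \<in> S" and t: "t < (\<integral>\<^sup>+y. h (x0, y) \<partial>M)"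
  \<comment> \<open>Finite values of \<open>s\<close> are chosen so that each level can be lowered
    strictly while its product with a mass stays above the target.\<close>
  obtain s where s: "simple_function M s" "s \<le> (\<lambda>y. h (x0, y))" "\<And>y. s y < top" "t < integral\<^sup>S M s"
    using t unfolding nn_integral_def_finite less_SUP_iff by blast
  define B where "B c = s -` {c} \<inter> T" for c
  have fins: "finite (range s)" using simple_functionD(1)[OF s(1)] by simp
  have sB: "s -` {c} \<in> sets borel" for c using simple_functionD(2)[OF s(1), of "{c}"] by simp
  then have Bb: "B c \<in> sets borel" for c using T by (auto simp: B_def)
  have "emeasure M (s -` {c}) = emeasure M (B c)" for c
  proof -
    have "- T \<in> null_sets M" using null T by (auto intro!: null_setsI)
    then have "emeasure M (s -` {c} - - T) = emeasure M (s -` {c})"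
      using sB by (intro emeasure_Diff_null_set) auto
    then show ?thesis by (simp add: B_def Diff_eq)
  qed
  then have "integral\<^sup>S M s = (\<Sum>c\<in>range s. c * emeasure M (B c))"
    by (simp add: simple_integral_def)
  then have "t < (\<Sum>c\<in>range s. c * emeasure M (B c))" using s(4) by simp
  \<comment> \<open>The target is distributed over the finitely many levels; a share 0 covers levels
    that contribute nothing.\<close>
  from ennreal_less_sum_approx[OF fins this]
  obtain b where b: "t < sum b (range s)" "\<And>c. c \<in> range s \<Longrightarrow> b c = 0 \<or> b c < c * emeasure M (B c)"
    by blast
  have Mfin: "emeasure M C < top" if "C \<in> sets borel" for C
  proof -
    have "emeasure M C \<le> emeasure M UNIV" by (rule emeasure_mono) auto
    then show ?thesis using fin by auto
  qed
  have "\<exists>K d. compact K \<and> K \<subseteq> B c \<and> b c \<le> d * emeasure M K \<and>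
      (\<forall>\<^sub>F x in at x0 within S. \<forall>y\<in>K. d \<le> h (x, y))" if c: "c \<in> range s" for c
  proof (cases "b c = 0")
    case True
    then show ?thesis by (intro exI[of _ "{}"] exI[of _ 0]) auto
  next
    case False
    have "c * emeasure M (B c) = (SUP K\<in>{K. compact K \<and> K \<subseteq> B c}. c * emeasure M K)"
      using Mfin Bb by (subst radon_inner_regular[OF M Bb]) (auto simp: SUP_mult_left_ennreal)
    then obtain K where K: "compact K" "K \<subseteq> B c" "b c < c * emeasure M K"
      using b(2)[OF c] False by (auto simp: less_SUP_iff)
    have ctop: "c < top" using c s(3) by auto
    obtain d where d: "d < c" "b c < d * emeasure M K"
      using ennreal_less_mult_approx[OF K(3) ctop Mfin[OF borel_compact[OF K(1)]]] by blast
    obtain W where W: "open W" "{p \<in> S \<times> T. d < h p} = (S \<times> T) \<inter> W"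
      by (rule lsc_on_open[OF h])
    have KT: "K \<subseteq> T" using K(2) by (auto simp: B_def)
    have "{x0} \<times> K \<subseteq> W"
    proof clarify
      fix y assume y: "y \<in> K"
      then have "s y = c" using K(2) by (auto simp: B_def)
      then have "d < h (x0, y)" using d(1) le_funD[OF s(2), of y] by auto
      then show "(x0, y) \<in> W" using W(2) x0 y KT by auto
    qed
    \<comment> \<open>Compactness of \<open>K\<close> makes one neighbourhood of \<open>x0\<close>
      serve all \<open>y\<close> in \<open>K\<close>.\<close>
    then obtain X0 where X0: "x0 \<in> X0" "open X0" "X0 \<times> K \<subseteq> W"
      using Elementary_Topology.tube_lemma[OF K(1) W(1)] by blast
    have "d \<le> h (x, y)" if "x \<in> X0" "x \<in> S" "y \<in> K" for x y
    proof -
      have "(x, y) \<in> {p \<in> S \<times> T. d < h p}" using W(2) X0(3) that KT by auto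
      then show ?thesis by auto
    qed
    then have "\<forall>\<^sub>F x in at x0 within S. \<forall>y\<in>K. d \<le> h (x, y)"
      using X0 unfolding eventually_at_topological by blast
    moreover have "b c \<le> d * emeasure M K" using d(2) by (rule less_imp_le)
    ultimately show ?thesis using K(1,2) by (intro exI[of _ K] exI[of _ d] conjI)
  qed
  then have "\<forall>c\<in>range s. \<exists>p. compact (fst p) \<and> fst p \<subseteq> B c \<and> b c \<le> snd p * emeasure M (fst p) \<and>
      (\<forall>\<^sub>F x in at x0 within S. \<forall>y\<in>fst p. snd p \<le> h (x, y))" (is "\<forall>c\<in>_. \<exists>p. ?P c p")
    by simp
  then obtain p where "\<forall>c\<in>range s. ?P c (p c)" by (rule bchoice[THEN exE])
  then have p: "?P c (p c)" if "c \<in> range s" for c using that by (rule bspec)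
  define K where "K c = fst (p c)" for c
  define d where "d c = snd (p c)" for c
  have K: "compact (K c)" "K c \<subseteq> B c" and d: "b c \<le> d c * emeasure M (K c)"
    and ev: "\<forall>\<^sub>F x in at x0 within S. \<forall>y\<in>K c. d c \<le> h (x, y)" if "c \<in> range s" for c
    using p[OF that] unfolding K_def d_def by blast+
  have "\<forall>\<^sub>F x in at x0 within S. \<forall>c\<in>range s. \<forall>y\<in>K c. d c \<le> h (x, y)"
    using ev by (intro eventually_ball_finite fins) auto
  then show "\<forall>\<^sub>F x in at x0 within S. t < (\<integral>\<^sup>+y. h (x, y) \<partial>M)"
  proof eventually_elim
    case (elim x)
    have "(\<Sum>c\<in>range s. d c * indicator (K c) y) \<le> h (x, y)" for y
    proof -
      \<comment> \<open>The compact pieces lie in different level sets, hence are disjoint, and at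
        most one term of the sum is nonzero at \<open>y\<close>.\<close>
      have "y \<notin> K c" if "c \<in> range s" "c \<noteq> s y" for c
        using K(2)[OF that(1)] that(2) by (auto simp: B_def)
      then have "(\<Sum>c\<in>range s. d c * indicator (K c) y) = (\<Sum>c\<in>{s y}. d c * indicator (K c) y)"
        using fins by (intro sum.mono_neutral_right) auto
      also have "\<dots> = d (s y) * indicator (K (s y)) y"
        by (simp only: sum.insert finite.emptyI empty_iff sum.empty add_0_right not_False_eq_True)
      also have "\<dots> \<le> h (x, y)" using elim by (auto simp: indicator_def)
      finally show ?thesis .
    qed
    then have "(\<integral>\<^sup>+y. (\<Sum>c\<in>range s. d c * indicator (K c) y) \<partial>M) \<le> (\<integral>\<^sup>+y. h (x, y) \<partial>M)"
      by (intro nn_integral_mono) auto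
    also have "(\<integral>\<^sup>+y. (\<Sum>c\<in>range s. d c * indicator (K c) y) \<partial>M)
        = (\<Sum>c\<in>range s. \<integral>\<^sup>+y. d c * indicator (K c) y \<partial>M)"
      using K(1) borel_compact
      by (intro nn_integral_sum borel_measurable_times_ennreal borel_measurable_const borel_measurable_indicator) auto
    also have "\<dots> = (\<Sum>c\<in>range s. d c * emeasure M (K c))"
      using K(1) borel_compact by (intro sum.cong nn_integral_cmult_indicator) auto
    finally have "(\<Sum>c\<in>range s. d c * emeasure M (K c)) \<le> (\<integral>\<^sup>+y. h (x, y) \<partial>M)" .
    moreover have "sum b (range s) \<le> (\<Sum>c\<in>range s. d c * emeasure M (K c))"
      using d by (intro sum_mono) auto
    ultimately show ?case using b(1) by auto
  qed
qed


section \<open>Potentials of vector measures\<close>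

lemma enn2ereal_diff_shift:
  assumes "P + b = U + N" "N < top" "b < top"
  shows "enn2ereal P - enn2ereal N = enn2ereal U - enn2ereal b"
proof -
  obtain n where n: "N = ennreal n" "0 \<le> n" using assms(2) by (cases N) auto
  obtain c where c: "b = ennreal c" "0 \<le> c" using assms(3) by (cases b) auto
  show ?thesis
  proof (cases P)
    case (real p)
    then have "U \<noteq> top" using assms(1) n c by (auto simp: ennreal_add_eq_top)
    then obtain u where u: "U = ennreal u" "0 \<le> u" by (cases U) auto
    then have "p + c = u + n" using assms(1) n c real by (simp flip: ennreal_plus)
    then show ?thesis using real u n c by simp
  next
    case top
    then have "U + N = top" using assms(1) by (metis ennreal_add_eq_top)
    then have "U = top" using n by (simp add: ennreal_add_eq_top)
    then show ?thesis using top n c by simp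
  qed
qed

text \<open>This is the decomposition of \<open>z\<close> into positive and negative part, rewritten
  without subtraction so that it can be integrated and summed in \<open>ennreal\<close>.\<close>

lemma e2ennreal_shift:
  assumes "ereal (- C) \<le> z" "0 \<le> C"
  shows "e2ennreal z + ennreal C = e2ennreal (z + ereal C) + e2ennreal (- z)"
proof (cases z)
  case (real r)
  have "ennreal r + ennreal C = ennreal (r + C) + ennreal (- r)"
  proof (cases "0 \<le> r")
    case True
    then show ?thesis using assms by (simp add: ennreal_neg)
  next
    case False
    then show ?thesis using assms real by (simp add: ennreal_neg flip: ennreal_plus)
  qed
  then show ?thesis using real by simp
qed (use assms in auto)

text \<open>The bound below makes the negative part integrable over a finite measure, so the
  additive identity for \<open>\<psi> x\<close> may be rearranged after integration even if the
  positive part has infinite integral.\<close>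

lemma pairing_shift:
  assumes "finite_measure M" and [measurable]: "\<psi> \<in> borel_measurable M"
    and C: "0 \<le> C" and ae: "AE x in M. ereal (- C) \<le> \<psi> x"
  shows "pairing \<psi> M = enn2ereal (\<integral>\<^sup>+x. e2ennreal (\<psi> x + ereal C) \<partial>M) - ereal (C * measure M (space M))"
proof -
  interpret finite_measure M by fact
  have Cint: "(\<integral>\<^sup>+x. ennreal C \<partial>M) = ennreal (C * measure M (space M))"
    using C by (simp add: emeasure_eq_measure ennreal_mult)
  have "(\<integral>\<^sup>+x. e2ennreal (\<psi> x) \<partial>M) + (\<integral>\<^sup>+x. ennreal C \<partial>M)
      = (\<integral>\<^sup>+x. e2ennreal (\<psi> x) + ennreal C \<partial>M)"
    by (intro nn_integral_add[symmetric]) measurable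
  also have "\<dots> = (\<integral>\<^sup>+x. e2ennreal (\<psi> x + ereal C) + e2ennreal (- \<psi> x) \<partial>M)"
    using ae by (intro nn_integral_cong_AE) (auto elim!: eventually_mono simp: e2ennreal_shift[OF _ C])
  also have "\<dots> = (\<integral>\<^sup>+x. e2ennreal (\<psi> x + ereal C) \<partial>M) + (\<integral>\<^sup>+x. e2ennreal (- \<psi> x) \<partial>M)"
    by (intro nn_integral_add) measurable
  finally have eq: "(\<integral>\<^sup>+x. e2ennreal (\<psi> x) \<partial>M) + ennreal (C * measure M (space M))
      = (\<integral>\<^sup>+x. e2ennreal (\<psi> x + ereal C) \<partial>M) + (\<integral>\<^sup>+x. e2ennreal (- \<psi> x) \<partial>M)"
    unfolding Cint .
  have "(\<integral>\<^sup>+x. e2ennreal (- \<psi> x) \<partial>M) \<le> (\<integral>\<^sup>+x. ennreal C \<partial>M)"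
  proof (intro nn_integral_mono_AE)
    show "AE x in M. e2ennreal (- \<psi> x) \<le> ennreal C"
      using ae
    proof eventually_elim
      case (elim x)
      then have "- \<psi> x \<le> ereal C" by (simp add: ereal_uminus_le_reorder)
      then show ?case using e2ennreal_mono by fastforce
    qed
  qed
  also have "\<dots> < top" unfolding Cint by simp
  finally have "(\<integral>\<^sup>+x. e2ennreal (- \<psi> x) \<partial>M) < top" .
  from enn2ereal_diff_shift[OF eq this] show ?thesis
    unfolding pairing_def using C by simp
qed

text \<open>Negation could fail at \<infinity> - \<infinity>, which has the value \<infinity> in
  either order. The bound above rules this out by making the positive part integrable.\<close>

lemma pairing_uminus:
  assumes "finite_measure M" and C: "0 \<le> C" and ae: "AE x in M. \<psi> x \<le> ereal C"
  shows "pairing (\<lambda>x. - \<psi> x) M = - pairing \<psi> M"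
proof -
  interpret finite_measure M by fact
  have "(\<integral>\<^sup>+x. e2ennreal (\<psi> x) \<partial>M) \<le> (\<integral>\<^sup>+x. ennreal C \<partial>M)"
    using ae e2ennreal_mono by (intro nn_integral_mono_AE) (fastforce elim!: eventually_mono)
  also have "\<dots> < top" by (simp add: emeasure_eq_measure ennreal_mult_less_top)
  finally obtain p where "(\<integral>\<^sup>+x. e2ennreal (\<psi> x) \<partial>M) = ennreal p" "0 \<le> p"
    by (cases "\<integral>\<^sup>+x. e2ennreal (\<psi> x) \<partial>M") auto
  then show ?thesis
    unfolding pairing_def by (cases "enn2ereal (\<integral>\<^sup>+x. e2ennreal (- \<psi> x) \<partial>M)") auto
qed

lemma ereal_series_shift:
  assumes t: "\<And>j. j \<in> J \<Longrightarrow> t j = enn2ereal (u j) - ereal (b j)" and b: "\<And>j. j \<in> J \<Longrightarrow> 0 \<le> b j"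
    and fin: "(\<Sum>\<^sub>\<infinity>j\<in>J. ennreal (b j)) < top"
  shows "ereal_series t J = enn2ereal (\<Sum>\<^sub>\<infinity>j\<in>J. u j) - enn2ereal (\<Sum>\<^sub>\<infinity>j\<in>J. ennreal (b j))"
proof -
  have ge: "ereal (- b j) \<le> t j" if "j \<in> J" for j
    using t[OF that] enn2ereal_nonneg[of "u j"] by (cases "enn2ereal (u j)") auto
  have tb: "t j + ereal (b j) = enn2ereal (u j)" if "j \<in> J" for j
    using t[OF that] enn2ereal_nonneg[of "u j"] by (cases "enn2ereal (u j)") auto
  have eq: "e2ennreal (t j) + ennreal (b j) = u j + e2ennreal (- t j)" if "j \<in> J" for j
    using e2ennreal_shift[OF ge[OF that] b[OF that]] by (simp add: tb[OF that])
  have "(\<Sum>\<^sub>\<infinity>j\<in>J. e2ennreal (t j)) + (\<Sum>\<^sub>\<infinity>j\<in>J. ennreal (b j)) = (\<Sum>\<^sub>\<infinity>j\<in>J. e2ennreal (t j) + ennreal (b j))"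
    by (intro infsum_add[symmetric] nonneg_summable_on_complete) simp_all
  also have "\<dots> = (\<Sum>\<^sub>\<infinity>j\<in>J. u j + e2ennreal (- t j))"
    by (rule infsum_cong) (rule eq)
  also have "\<dots> = (\<Sum>\<^sub>\<infinity>j\<in>J. u j) + (\<Sum>\<^sub>\<infinity>j\<in>J. e2ennreal (- t j))"
    by (intro infsum_add nonneg_summable_on_complete) simp_all
  finally have sums: "(\<Sum>\<^sub>\<infinity>j\<in>J. e2ennreal (t j)) + (\<Sum>\<^sub>\<infinity>j\<in>J. ennreal (b j))
      = (\<Sum>\<^sub>\<infinity>j\<in>J. u j) + (\<Sum>\<^sub>\<infinity>j\<in>J. e2ennreal (- t j))" .
  have "e2ennreal (- t j) \<le> ennreal (b j)" if "j \<in> J" for j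
  proof -
    have "- t j \<le> ereal (b j)" using ge[OF that] by (cases "t j") auto
    then show ?thesis using e2ennreal_mono by fastforce
  qed
  then have "(\<Sum>\<^sub>\<infinity>j\<in>J. e2ennreal (- t j)) \<le> (\<Sum>\<^sub>\<infinity>j\<in>J. ennreal (b j))"
    by (intro infsum_mono nonneg_summable_on_complete) simp_all
  also note fin
  finally show ?thesis
    unfolding ereal_series_def by (rule enn2ereal_diff_shift[OF sums]) (rule fin)
qed

text \<open>On \<open>B i\<close> every signed term is a nonnegative lower semicontinuous integral
  \<open>u j x\<close> minus the finite number \<open>b j\<close>. The numbers \<open>b j\<close>
  are summable, so the whole potential is a nonnegative series minus one finite constant; this also
  excludes the value -\<infinity>.\<close>

lemma lsc_on_vector_potential:
  fixes \<kappa> :: "'a::t2_space \<times> 'a \<Rightarrow> ereal" and lam :: "'i \<Rightarrow> 'a measure"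
  assumes ker: "kernel \<kappa>"
    and radon: "\<And>j. j \<in> I \<Longrightarrow> radon_measure (lam j)"
    and mass: "(\<Sum>\<^sub>\<infinity>j\<in>I. emeasure (lam j) UNIV) < top"
    and clo: "\<And>j. j \<in> I \<Longrightarrow> closed (B j)"
    and conc: "\<And>j. j \<in> I \<Longrightarrow> emeasure (lam j) (- B j) = 0"
    and I: "I = Ipos \<union> Ineg" "Ipos \<inter> Ineg = {}"
    and bdd: "(SUP p\<in>(\<Union>i\<in>Ipos. B i) \<times> (\<Union>j\<in>Ineg. B j). \<kappa> p) < \<infinity>"
    and cont: "continuous_on ((\<Union>i\<in>Ipos. B i) \<times> (\<Union>j\<in>Ineg. B j)) \<kappa>"
    and finite: "\<And>p. p \<in> (\<Union>i\<in>Ipos. B i) \<times> (\<Union>j\<in>Ineg. B j) \<Longrightarrow> \<bar>\<kappa> p\<bar> \<noteq> \<infinity>"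
    and i: "i \<in> I"
  shows "lsc_on (B i) (vector_potential \<kappa> Ipos Ineg lam i)"
    and "\<And>x. x \<in> B i \<Longrightarrow> vector_potential \<kappa> Ipos Ineg lam i x \<noteq> -\<infinity>"
proof -
  let ?Bp = "\<Union>i\<in>Ipos. B i" and ?Bm = "\<Union>j\<in>Ineg. B j"
  have sym: "\<kappa> (x, y) = \<kappa> (y, x)" for x y using ker unfolding kernel_def by blast
  have kopen: "open {p. t < \<kappa> p}" for t using ker by (simp add: kernel_def Psi_class_def)
  have kfin: "\<kappa> p \<noteq> -\<infinity>" for p using ker unfolding kernel_def Psi_class_def by blast
  obtain c :: real where c: "0 \<le> c" "\<And>p. ereal (- c) \<le> \<kappa> p"
    by (rule kernel_lower_bound[OF ker]) blast
  \<comment> \<open>The maximum serves both signs: it bounds the negative of the kernel everywhere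
    and the kernel itself between opposite plates.\<close>
  define C where "C = max c (real_of_ereal (SUP p\<in>?Bp \<times> ?Bm. \<kappa> p))"
  have C0: "0 \<le> C" using c(1) by (simp add: C_def)
  have Clow: "ereal (- C) \<le> \<kappa> p" for p
  proof -
    have "ereal (- C) \<le> ereal (- c)" by (simp add: C_def)
    then show ?thesis using c(2) by (rule order_trans)
  qed
  have Cup: "\<kappa> p \<le> ereal C" if p: "p \<in> ?Bp \<times> ?Bm" for p
  proof -
    have le: "\<kappa> p \<le> (SUP p\<in>?Bp \<times> ?Bm. \<kappa> p)" using p by (rule SUP_upper)
    moreover have "(SUP p\<in>?Bp \<times> ?Bm. \<kappa> p) \<noteq> -\<infinity>" using le kfin[of p] by auto
    ultimately have "\<kappa> p \<le> ereal (real_of_ereal (SUP p\<in>?Bp \<times> ?Bm. \<kappa> p))"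
      using bdd by (cases "SUP p\<in>?Bp \<times> ?Bm. \<kappa> p") auto
    then show ?thesis by (rule order_trans) (simp add: C_def)
  qed
  define s where "s j = plate_sign Ipos i * plate_sign Ipos j" for j
  \<comment> \<open>Continuity and boundedness are stated only for positive plate times negative
    plate, so for negative \<open>i\<close> the factors occur in reversed order and the symmetry of
    the kernel is used.\<close>
  have s_cases: "s j = 1 \<or> s j = -1 \<and> B i \<times> B j \<subseteq> ?Bp \<times> ?Bm \<or> s j = -1 \<and> B j \<times> B i \<subseteq> ?Bp \<times> ?Bm"
    if j: "j \<in> I" for j
    using i j I by (auto simp: s_def plate_sign_def)
  \<comment> \<open>On \<open>B i \<times> B j\<close> the shifted value is nonnegative, so the
    truncation in \<open>e2ennreal\<close> changes nothing there.\<close>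
  define h where "h j p = e2ennreal (s j * \<kappa> p + ereal C)" for j p
  define u where "u j x = (\<integral>\<^sup>+y. h j (x, y) \<partial>lam j)" for j x
  define b where "b j = C * measure (lam j) UNIV" for j
  have mfin: "emeasure (lam j) UNIV < top" if "j \<in> I" for j
  proof -
    have "emeasure (lam j) UNIV \<le> (\<Sum>\<^sub>\<infinity>j\<in>I. emeasure (lam j) UNIV)"
      using that SUP_upper[of "{j}" "{F. finite F \<and> F \<subseteq> I}" "sum (\<lambda>j. emeasure (lam j) UNIV)"]
      by (simp add: nonneg_infsum_complete)
    then show ?thesis using mass by (rule le_less_trans)
  qed
  have lsc_h: "lsc_on (B i \<times> B j) (h j)" if j: "j \<in> I" for j
  proof -
    have const: "lsc_on S (\<lambda>_. ereal C)" for S :: "('a \<times> 'a) set"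
      by (rule lsc_on_continuous) (rule continuous_on_const)
    have "lsc_on (B i \<times> B j) (\<lambda>p. s j * \<kappa> p + ereal C)"
      using s_cases[OF j]
    proof (elim disjE conjE)
      assume "s j = 1"
      then show ?thesis
        using kfin by (auto intro!: lsc_on_add_ereal const lsc_onI_open[OF kopen])
    next
      assume s: "s j = -1" and sub: "B i \<times> B j \<subseteq> ?Bp \<times> ?Bm"
      have "continuous_on (B i \<times> B j) (\<lambda>p. - \<kappa> p)"
        by (rule continuous_on_compose2[OF continuous_uminus_ereal continuous_on_subset[OF cont sub]]) auto
      then have "lsc_on (B i \<times> B j) (\<lambda>p. - \<kappa> p + ereal C)"
        using finite sub by (intro lsc_on_add_ereal const lsc_on_continuous) force+
      then show ?thesis using s by simp
    next
      assume s: "s j = -1" and sub: "B j \<times> B i \<subseteq> ?Bp \<times> ?Bm"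
      have "continuous_on (B i \<times> B j) (\<lambda>p. \<kappa> (prod.swap p))"
      proof (rule continuous_on_compose2[OF cont continuous_on_swap])
        show "prod.swap ` (B i \<times> B j) \<subseteq> ?Bp \<times> ?Bm"
        proof (rule image_subsetI)
          fix p assume "p \<in> B i \<times> B j"
          then have "prod.swap p \<in> B j \<times> B i" by (cases p) simp
          then show "prod.swap p \<in> ?Bp \<times> ?Bm" by (rule subsetD[OF sub])
        qed
      qed
      moreover have "\<kappa> (prod.swap p) = \<kappa> p" for p by (cases p) (simp add: sym)
      ultimately have "continuous_on (B i \<times> B j) \<kappa>" by simp
      then have "continuous_on (B i \<times> B j) (\<lambda>p. - \<kappa> p)"
        by (rule continuous_on_compose2[OF continuous_uminus_ereal]) auto
      \<comment> \<open>Finiteness between opposite plates is what keeps the sign-reversed kernel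
        away from -\<infinity>, as adding semicontinuous functions demands.\<close>
      moreover have "- \<kappa> p \<noteq> -\<infinity>" if "p \<in> B i \<times> B j" for p
      proof -
        have "prod.swap p \<in> B j \<times> B i" using that by (cases p) simp
        then have "\<bar>\<kappa> (prod.swap p)\<bar> \<noteq> \<infinity>" by (intro finite subsetD[OF sub])
        then show ?thesis using sym by (cases p) auto
      qed
      ultimately have "lsc_on (B i \<times> B j) (\<lambda>p. - \<kappa> p + ereal C)"
        by (intro lsc_on_add_ereal const lsc_on_continuous) auto
      then show ?thesis using s by simp
    qed
    then show ?thesis unfolding h_def by (rule lsc_on_e2ennreal)
  qed
  have lsc_u: "lsc_on (B i) (u j)" if j: "j \<in> I" for j
    unfolding u_def using mfin[OF j] clo[OF j]
    by (intro lsc_on_nn_integral[OF radon[OF j] _ _ conc[OF j] lsc_h[OF j]]) auto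
  have term_eq: "s j * potential \<kappa> (lam j) x = enn2ereal (u j x) - ereal (b j)"
    if j: "j \<in> I" and x: "x \<in> B i" for j x
  proof -
    note M = radon[OF j]
    have fm: "finite_measure (lam j)"
      using mfin[OF j] radon_measure_space[OF M] by (intro finite_measureI) simp
    have meas: "(\<lambda>y. \<kappa> (x, y)) \<in> borel_measurable (lam j)"
    proof (rule borel_measurableI_greater)
      fix t
      have "open ((\<lambda>y. (x, y)) -` {p. t < \<kappa> p})"
        by (intro open_vimage kopen continuous_intros)
      then have "open {y. t < \<kappa> (x, y)}" by (simp add: vimage_def)
      then show "{y \<in> space (lam j). t < \<kappa> (x, y)} \<in> sets (lam j)"
        by (simp add: radon_measure_space[OF M] radon_measure_sets[OF M])
    qed
    have ae: "AE y in lam j. y \<in> B j"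
      using conc[OF j] clo[OF j] radon_measure_sets[OF M] radon_measure_space[OF M]
      by (intro AE_I[of _ _ "- B j"]) auto
    have shift: "pairing \<psi> (lam j) = enn2ereal (\<integral>\<^sup>+y. e2ennreal (\<psi> y + ereal C) \<partial>lam j) - ereal (b j)"
      if "\<psi> \<in> borel_measurable (lam j)" "AE y in lam j. ereal (- C) \<le> \<psi> y" for \<psi>
      using pairing_shift[OF fm that(1) C0 that(2)] by (simp add: b_def radon_measure_space[OF M])
    consider "s j = 1" | "s j = -1" "AE y in lam j. \<kappa> (x, y) \<le> ereal C"
    proof (cases "s j = 1")
      case False
      then have "s j = -1" using s_cases[OF j] by auto
      moreover have "AE y in lam j. \<kappa> (x, y) \<le> ereal C"
        using ae
      proof eventually_elim
        case (elim y)
        then have "(x, y) \<in> ?Bp \<times> ?Bm \<or> (y, x) \<in> ?Bp \<times> ?Bm"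
          using s_cases[OF j] False x by blast
        then show ?case using Cup sym by metis
      qed
      ultimately show ?thesis using that by blast
    qed (use that in blast)
    then show ?thesis
    proof cases
      case 1
      then show ?thesis
        unfolding potential_def u_def h_def using Clow by (subst shift[OF meas]) auto
    next
      case 2
      have "s j * potential \<kappa> (lam j) x = pairing (\<lambda>y. - \<kappa> (x, y)) (lam j)"
        using pairing_uminus[OF fm C0 2(2)] 2(1) by (simp add: potential_def)
      also have "\<dots> = enn2ereal (\<integral>\<^sup>+y. e2ennreal (- \<kappa> (x, y) + ereal C) \<partial>lam j) - ereal (b j)"
      proof (rule shift)
        show "(\<lambda>y. - \<kappa> (x, y)) \<in> borel_measurable (lam j)" using meas by measurable
        show "AE y in lam j. ereal (- C) \<le> - \<kappa> (x, y)"
          using 2(2) by eventually_elim (metis ereal_minus_le_minus uminus_ereal.simps(1))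
      qed
      finally show ?thesis unfolding u_def h_def using 2(1) by simp
    qed
  qed
  define b' where "b' = (\<Sum>\<^sub>\<infinity>j\<in>I. ennreal (b j))"
  have bfin: "b' < top"
  proof -
    have "ennreal (b j) = ennreal C * emeasure (lam j) UNIV" if "j \<in> I" for j
      using mfin[OF that] C0 by (simp add: b_def ennreal_mult emeasure_eq_ennreal_measure)
    then have "b' = (\<Sum>\<^sub>\<infinity>j\<in>I. ennreal C * emeasure (lam j) UNIV)"
      unfolding b'_def by (intro infsum_cong)
    also have "\<dots> = ennreal C * (\<Sum>\<^sub>\<infinity>j\<in>I. emeasure (lam j) UNIV)"
      by (simp add: nonneg_infsum_complete SUP_mult_left_ennreal sum_distrib_left)
    also have "\<dots> < top" using mass by (simp add: ennreal_mult_less_top)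
    finally show ?thesis .
  qed
  obtain d where d: "b' = ennreal d" "0 \<le> d" using bfin by (cases b') auto
  have eq: "vector_potential \<kappa> Ipos Ineg lam i x = enn2ereal (\<Sum>\<^sub>\<infinity>j\<in>I. u j x) + ereal (- d)"
    if x: "x \<in> B i" for x
  proof -
    have "vector_potential \<kappa> Ipos Ineg lam i x = ereal_series (\<lambda>j. s j * potential \<kappa> (lam j) x) I"
      by (simp add: vector_potential_def s_def I(1))
    also have "\<dots> = enn2ereal (\<Sum>\<^sub>\<infinity>j\<in>I. u j x) - enn2ereal b'"
      unfolding b'_def
    proof (rule ereal_series_shift)
      show "s j * potential \<kappa> (lam j) x = enn2ereal (u j x) - ereal (b j)" if "j \<in> I" for j
        by (rule term_eq[OF that x])
      show "0 \<le> b j" for j using C0 by (simp add: b_def)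
      show "(\<Sum>\<^sub>\<infinity>j\<in>I. ennreal (b j)) < top" using bfin by (simp add: b'_def)
    qed
    finally show ?thesis using d by (simp add: minus_ereal_def)
  qed
  show "vector_potential \<kappa> Ipos Ineg lam i x \<noteq> -\<infinity>" if "x \<in> B i" for x
    using eq[OF that] enn2ereal_neq_MInf[of "\<Sum>\<^sub>\<infinity>j\<in>I. u j x"] by (cases "enn2ereal (\<Sum>\<^sub>\<infinity>j\<in>I. u j x)") auto
  have "lsc_on (B i) (\<lambda>x. enn2ereal (\<Sum>\<^sub>\<infinity>j\<in>I. u j x) + ereal (- d))"
  proof (rule lsc_on_add_ereal)
    show "lsc_on (B i) (\<lambda>x. enn2ereal (\<Sum>\<^sub>\<infinity>j\<in>I. u j x))"
      by (intro lsc_on_enn2ereal lsc_on_infsum_ennreal lsc_u)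
    show "lsc_on (B i) (\<lambda>_. ereal (- d))"
      by (rule lsc_on_continuous) (rule continuous_on_const)
  qed (simp_all add: enn2ereal_neq_MInf)
  then show "lsc_on (B i) (vector_potential \<kappa> Ipos Ineg lam i)"
    by (subst lsc_on_cong[OF eq])
qed

text \<open>Being carried by \<open>Q\<close> controls only compact parts of the complement. A
  positive integrable \<open>g\<close> exhausts the complement by countably many sets of finite
  measure, and there inner regularity turns local negligibility into nullity.\<close>

lemma radon_carried_null:
  assumes M: "M \<in> radon_carried Q" and Q: "Q \<in> sets borel"
    and g: "continuous_on UNIV g" "\<And>x. 0 < g x" and fin: "(\<integral>\<^sup>+x. ennreal (g x) \<partial>M) < \<infinity>"
  shows "emeasure M (- Q) = 0"
proof -
  have R: "radon_measure M" and loc: "locally_negligible M (- Q)"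
    using M by (auto simp: radon_carried_def)
  note [simp] = radon_measure_sets[OF R] radon_measure_space[OF R]
  define G where "G n = {x. 1 / real (Suc n) < g x} - Q" for n
  have Gb: "G n \<in> sets borel" for n
  proof -
    have "open {x. 1 / real (Suc n) < g x}"
      by (intro open_Collect_less continuous_on_const g)
    then show ?thesis unfolding G_def using Q by auto
  qed
  have "G n \<in> null_sets M" for n
  proof -
    have "ennreal (1 / real (Suc n)) * emeasure M (G n) = (\<integral>\<^sup>+x. ennreal (1 / real (Suc n)) * indicator (G n) x \<partial>M)"
      using Gb by (simp add: nn_integral_cmult_indicator)
    also have "\<dots> \<le> (\<integral>\<^sup>+x. ennreal (g x) \<partial>M)"
      by (intro nn_integral_mono) (auto simp: G_def indicator_def intro!: ennreal_leI)
    finally have "ennreal (1 / real (Suc n)) * emeasure M (G n) < \<infinity>" using fin by (rule le_less_trans)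
    then have Gfin: "emeasure M (G n) < \<infinity>"
      by (auto simp: ennreal_mult_less_top)
    have "emeasure M (G n) = 0"
    proof (rule ccontr)
      assume "emeasure M (G n) \<noteq> 0"
      then obtain K where K: "compact K" "K \<subseteq> G n" "0 < emeasure M K"
        by (rule radon_positive_compact[OF R Gb Gfin])
      have "- Q \<inter> K = K" using K(2) by (auto simp: G_def)
      then have "K \<in> null_sets (completion M)" using loc K(1) by (metis locally_negligible_def)
      then have "emeasure (completion M) K = 0" by (rule null_setsD1)
      moreover have "K \<in> sets M" using borel_compact[OF K(1)] by simp
      ultimately show False using K(3) by simp
    qed
    then show ?thesis using Gb by (intro null_setsI) auto
  qed
  then have "(\<Union>n. G n) \<in> null_sets M" by (intro null_sets_UN) auto
  moreover have "(\<Union>n. G n) = - Q"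
  proof -
    have "\<exists>n. 1 / real (Suc n) < g x" for x
      using reals_Archimedean[OF g(2)[of x]] by (simp add: inverse_eq_divide)
    then show ?thesis by (auto simp: G_def)
  qed
  ultimately show ?thesis by auto
qed

text \<open>Chebyshev's inequality with the lower bound of \<open>g\<close> on \<open>Q\<close>. If
  that bound is 0, the right-hand side is infinite because \<open>a\<close> is positive.\<close>

lemma radon_carried_mass:
  assumes M: "M \<in> radon_carried Q" and Q: "Q \<in> sets borel"
    and g: "continuous_on UNIV g" "\<And>x. 0 < g x" and a: "0 < a" "pairing (\<lambda>x. ereal (g x)) M = ereal a"
  shows "emeasure M (- Q) = 0"
    and "emeasure M UNIV \<le> ennreal a * inverse (INF x\<in>Q. ennreal (g x))"
proof -
  have R: "radon_measure M" using M by (auto simp: radon_carried_def)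
  note [simp] = radon_measure_sets[OF R] radon_measure_space[OF R]
  have "enn2ereal (\<integral>\<^sup>+x. ennreal (g x) \<partial>M) = ereal a"
    using a(2) g(2) by (simp add: pairing_def ennreal_neg less_imp_le zero_ennreal.rep_eq)
  then have int: "(\<integral>\<^sup>+x. ennreal (g x) \<partial>M) = ennreal a"
    using a(1) by (metis e2ennreal_enn2ereal e2ennreal_ereal)
  show null: "emeasure M (- Q) = 0"
    by (rule radon_carried_null[OF M Q g]) (simp add: int)
  have "emeasure M UNIV \<le> emeasure M Q + emeasure M (- Q)"
    using emeasure_subadditive[of Q M "- Q"] Q by (auto simp: Un_commute)
  then have MQ: "emeasure M UNIV \<le> emeasure M Q" using null by simp
  define d where "d = (INF x\<in>Q. ennreal (g x))"
  have "d * emeasure M Q = (\<integral>\<^sup>+x. d * indicator Q x \<partial>M)"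
    using Q by (simp add: nn_integral_cmult_indicator)
  also have "\<dots> \<le> (\<integral>\<^sup>+x. ennreal (g x) \<partial>M)"
    by (intro nn_integral_mono) (auto simp: d_def indicator_def intro: INF_lower)
  finally have dM: "d * emeasure M Q \<le> ennreal a" by (simp add: int)
  have "emeasure M Q \<le> ennreal a * inverse d"
  proof (cases "d = 0 \<or> d = top")
    case True
    then show ?thesis
    proof
      assume "d = 0"
      then show ?thesis using a(1) by (simp add: ennreal_mult_top)
    next
      \<comment> \<open>Since \<open>g\<close> is finite, this happens only for empty
        \<open>Q\<close>, where the infimum is taken over the empty set.\<close>
      assume "d = top"
      then have "emeasure M Q = 0"
        using dM by (cases "emeasure M Q = 0") (auto simp: ennreal_top_mult top_unique)
      then show ?thesis by simp
    qed
  next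
    case False
    then have "emeasure M Q = emeasure M Q * d / d"
      by (intro mult_divide_eq_ennreal[symmetric]) auto
    also have "\<dots> \<le> ennreal a / d"
      using dM by (intro divide_right_mono_ennreal) (simp add: mult.commute)
    finally show ?thesis by (simp add: divide_ennreal_def)
  qed
  then show "emeasure M UNIV \<le> ennreal a * inverse (INF x\<in>Q. ennreal (g x))"
    using MQ unfolding d_def by (rule order_trans[rotated])
qed

text \<open>The set where \<open>H\<close> exceeds \<open>t\<close> within \<open>C\<close> is the
  trace of an open \<open>U\<close>. As \<open>M\<close> does not charge the complement of
  \<open>C\<close>, the whole of \<open>U\<close> is null, and a null open set contains no point of
  the support.\<close>

lemma lsc_on_le_msupport:
  fixes H :: "'a::t2_space \<Rightarrow> ereal"
  assumes R: "radon_measure M" and H: "lsc_on C H" and C: "closed C" "emeasure M (- C) = 0"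
    and ae: "AE x in M. H x \<le> t" and x: "x \<in> msupport M"
  shows "H x \<le> t"
proof (rule ccontr)
  assume "\<not> H x \<le> t"
  note [simp] = radon_measure_sets[OF R] radon_measure_space[OF R]
  obtain U where U: "open U" "{x\<in>C. t < H x} = C \<inter> U" by (rule lsc_on_open[OF H])
  have "x \<in> C" using msupport_subset_closed[OF C] x by auto
  then have "x \<in> {x\<in>C. t < H x}" using \<open>\<not> H x \<le> t\<close> by simp
  then have "x \<in> U" unfolding U(2) by simp
  have "- C \<in> null_sets M" using C by (intro null_setsI) auto
  then have "AE y in M. y \<notin> - C" by (rule AE_not_in)
  then have "AE y in M. y \<notin> U" using ae
  proof eventually_elim
    case (elim y)
    then have "y \<notin> {x\<in>C. t < H x}" by (simp add: not_less)
    then show ?case using elim(1) unfolding U(2) by simp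
  qed
  then have "U \<in> null_sets M" using U(1) by (subst (asm) AE_iff_null) auto
  then have "emeasure M U = 0" by (rule null_setsD1)
  moreover have "0 < emeasure M U" using x U(1) \<open>x \<in> U\<close> unfolding msupport_def by blast
  ultimately show False by simp
qed

theorem corollary8p3:
  fixes \<kappa> :: "'a::t2_space \<times> 'a \<Rightarrow> ereal"
    and Ipos Ineg I I0 :: "'i set"
    and A Ac :: "'i \<Rightarrow> 'a set"
    and Acp Acm :: "'a set"
    and a w :: "'i \<Rightarrow> real"
    and g :: "'i \<Rightarrow> 'a \<Rightarrow> real"
    and f W :: "'i \<Rightarrow> 'a \<Rightarrow> ereal"
    and \<xi> lam :: "'i \<Rightarrow> 'a measure"
  defines "I \<equiv> Ipos \<union> Ineg"
    and "Acp \<equiv> (\<Union>i\<in>Ipos. Ac i)"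
    and "Acm \<equiv> (\<Union>i\<in>Ineg. Ac i)"
    and "W \<equiv> weighted_potential \<kappa> Ipos Ineg f lam"
  assumes "locally_compact_space (euclidean :: 'a topology)"
    and "positive_definite_kernel \<kappa>"
    and "generalized_condenser Ipos Ineg A"
    and "\<And>i. i \<in> I \<Longrightarrow> 0 < a i"
    and "\<And>i. i \<in> I \<Longrightarrow> continuous_on UNIV (g i)"
    and "\<And>i x. i \<in> I \<Longrightarrow> 0 < g i x"
    and "\<And>i. i \<in> I \<Longrightarrow> universally_measurable (f i)"
    and "I0 \<subseteq> I"
    and "\<And>i. i \<in> I0 \<Longrightarrow> \<xi> i \<in> radon_carried (A i)"
    and "\<And>i. i \<in> I0 \<Longrightarrow> ereal (a i) < pairing (\<lambda>x. ereal (g i x)) (\<xi> i)"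
    and "admissible_vectors \<kappa> Ipos Ineg A a g f I0 \<xi> \<noteq> {}"
    and "countable_at_infinity TYPE('a) \<or> (\<forall>i\<in>I. 0 < (INF x\<in>A i. g i x))"
    and "\<And>i. i \<in> I \<Longrightarrow> nearly_closed_by \<kappa> (A i) (Ac i)"
    and "locally_finite_family I Ac"
    and "(\<Sum>\<^sub>\<infinity>i\<in>I. ennreal (a i) * inverse (INF x\<in>A i. ennreal (g i x))) < \<infinity>"
    and "(SUP p\<in>Acp \<times> Acm. \<kappa> p) < \<infinity>"
    and "\<And>i. i \<in> I \<Longrightarrow> bdd_above (g i ` Ac i)"
    and "\<And>i K. \<lbrakk>i \<in> I0; compact K; K \<subseteq> finite_part (f i) (A i)\<rbrakk>
           \<Longrightarrow> density (\<xi> i) (indicator K) \<in> finite_energy_pos \<kappa> UNIV"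
    and "\<And>i. i \<in> I0 \<Longrightarrow> A i - finite_part (f i) (A i) \<in> null_sets (completion (\<xi> i))"
    and "\<And>i. i \<in> I \<Longrightarrow> \<exists>c::real. \<forall>x\<in>Ac i. ereal c \<le> f i x"
    and "continuous_on (Acp \<times> Acm) \<kappa>" "\<And>p. p \<in> Acp \<times> Acm \<Longrightarrow> \<bar>\<kappa> p\<bar> \<noteq> \<infinity>"
    and "\<And>i. i \<in> I \<Longrightarrow> f i \<in> Psi_class"
    and "lam \<in> admissible_vectors \<kappa> Ipos Ineg A a g f I0 \<xi>"
    and "\<And>i. i \<in> I0 \<Longrightarrow> AE x in diff_measure (\<xi> i) (lam i). W i x \<ge> ereal (w i * g i x)"
    and "\<And>i. i \<in> I - I0 \<Longrightarrow> nearly_everywhere \<kappa> (A i) (\<lambda>x. W i x \<ge> ereal (w i * g i x))"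
  shows "((\<forall>i\<in>I0. AE x in lam i. W i x \<le> ereal (w i * g i x)) \<and>
          (\<forall>i\<in>I - I0. AE x in lam i. W i x = ereal (w i * g i x)))
         \<longleftrightarrow>
         ((\<forall>i\<in>I0. \<forall>x\<in>msupport (lam i). W i x \<le> ereal (w i * g i x)) \<and>
          (\<forall>i\<in>I - I0. nearly_everywhere \<kappa> (msupport (lam i)) (\<lambda>x. W i x = ereal (w i * g i x))))"
proof -
  have I: "I = Ipos \<union> Ineg" and Acp: "Acp = (\<Union>i\<in>Ipos. Ac i)" and Acm: "Acm = (\<Union>i\<in>Ineg. Ac i)"
    and W: "W = weighted_potential \<kappa> Ipos Ineg f lam"
    using assms(1-4) by simp_all
  note pd = assms(6) and cond = assms(7) and a = assms(8) and gcont = assms(9) and gpos = assms(10)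
    and I0 = assms(12) and nc = assms(17) and asum = assms(19) and kbdd = assms(20)
    and kcont = assms(25) and kfin = assms(26) and fPsi = assms(27) and lam = assms(28)
    and ne = assms(30)
  have ker: "kernel \<kappa>" using pd by (simp add: positive_definite_kernel_def)
  have disj: "Ipos \<inter> Ineg = {}"
    using cond by (simp add: generalized_condenser_def)
  have Ab: "A i \<in> sets borel" if "i \<in> I" for i
    using cond that by (simp add: generalized_condenser_def I)
  have carried: "lam i \<in> radon_carried (A i)" and energy: "\<bar>mutual_energy \<kappa> (lam i) (lam i)\<bar> \<noteq> \<infinity>"
    and pair: "pairing (\<lambda>x. ereal (g i x)) (lam i) = ereal (a i)" if i: "i \<in> I" for i
  proof -
    show "lam i \<in> radon_carried (A i)" "pairing (\<lambda>x. ereal (g i x)) (lam i) = ereal (a i)"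
      using lam i by (simp_all add: admissible_vectors_def finite_energy_vectors_def I)
    have "finite_series (\<lambda>(i, j). plate_sign Ipos i * plate_sign Ipos j * mutual_energy \<kappa> (lam i) (lam j)) (I \<times> I)"
      using lam by (simp add: admissible_vectors_def finite_energy_vectors_def I)
    \<comment> \<open>Finiteness of the double series includes that of its diagonal terms, where the
      sign squares to 1.\<close>
    then have "\<bar>plate_sign Ipos i * plate_sign Ipos i * mutual_energy \<kappa> (lam i) (lam i)\<bar> \<noteq> \<infinity>"
      using i by (auto simp: finite_series_def)
    then show "\<bar>mutual_energy \<kappa> (lam i) (lam i)\<bar> \<noteq> \<infinity>"
      by (simp add: plate_sign_def split: if_splits)
  qed
  have radon: "radon_measure (lam i)" if "i \<in> I" for i
    using carried[OF that] by (simp add: radon_carried_def)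
  have nullA: "emeasure (lam i) (- A i) = 0"
    and massA: "emeasure (lam i) UNIV \<le> ennreal (a i) * inverse (INF x\<in>A i. ennreal (g i x))" if i: "i \<in> I" for i
    using radon_carried_mass[OF carried[OF i] Ab[OF i] gcont[OF i] gpos[OF i] a[OF i] pair[OF i]] by blast+
  have mass: "(\<Sum>\<^sub>\<infinity>j\<in>I. emeasure (lam j) UNIV) < top"
  proof -
    have "(\<Sum>\<^sub>\<infinity>j\<in>I. emeasure (lam j) UNIV) \<le> (\<Sum>\<^sub>\<infinity>i\<in>I. ennreal (a i) * inverse (INF x\<in>A i. ennreal (g i x)))"
      using massA by (intro infsum_mono nonneg_summable_on_complete) simp_all
    then show ?thesis using asum by simp
  qed
  have mfin: "emeasure (lam i) B < \<infinity>" if i: "i \<in> I" for i B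
  proof -
    have "emeasure (lam i) B \<le> emeasure (lam i) UNIV"
      by (rule emeasure_mono) (simp_all add: radon_measure_sets[OF radon[OF i]])
    also have "\<dots> \<le> (\<Sum>\<^sub>\<infinity>j\<in>I. emeasure (lam j) UNIV)"
      using i SUP_upper[of "{i}" "{F. finite F \<and> F \<subseteq> I}" "sum (\<lambda>j. emeasure (lam j) UNIV)"]
      by (simp add: nonneg_infsum_complete)
    finally show ?thesis using mass by simp
  qed
  have clo: "closed (Ac i)" and capdiff: "inner_capacity \<kappa> ((A i - Ac i) \<union> (Ac i - A i)) = 0" if "i \<in> I" for i
    using nc[OF that] by (simp_all add: nearly_closed_by_def)
  have Acb: "Ac i \<in> sets borel" if "i \<in> I" for i using clo[OF that] by simp
  have nullAc: "emeasure (lam i) (- Ac i) = 0" if i: "i \<in> I" for i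
  proof -
    note [simp] = radon_measure_sets[OF radon[OF i]]
    have "emeasure (lam i) (A i - Ac i) = 0"
      using Ab[OF i] Acb[OF i] energy[OF i] mfin[OF i] capdiff[OF i]
      by (intro capacity_zero_imp_null[OF pd radon[OF i]]) auto
    \<comment> \<open>The complement of \<open>Ac i\<close> is covered by a part of capacity zero
      and a part outside the plate.\<close>
    then have "(A i - Ac i) \<union> - A i \<in> null_sets (lam i)"
      using nullA[OF i] Ab[OF i] Acb[OF i] by (intro null_sets.Un null_setsI) auto
    then have "- Ac i \<in> null_sets (lam i)"
      by (rule null_sets_subset) (use Acb[OF i] in auto)
    then show ?thesis by (rule null_setsD1)
  qed
  \<comment> \<open>Subtracting the finite continuous term turns the relations into comparisons of
    one semicontinuous function with 0, also where \<open>W i x\<close> is infinite.\<close>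
  define H where "H i x = W i x + ereal (- (w i * g i x))" for i x
  have H_iff: "W i x \<le> ereal (w i * g i x) \<longleftrightarrow> H i x \<le> 0" "W i x \<ge> ereal (w i * g i x) \<longleftrightarrow> H i x \<ge> 0"
    "W i x = ereal (w i * g i x) \<longleftrightarrow> H i x = 0" for i x
    by (cases "W i x"; simp add: H_def)+
  have lscH: "lsc_on (Ac i) (H i)" if i: "i \<in> I" for i
  proof -
    have V: "lsc_on (Ac i) (vector_potential \<kappa> Ipos Ineg lam i)"
      and Vfin: "\<And>x. x \<in> Ac i \<Longrightarrow> vector_potential \<kappa> Ipos Ineg lam i x \<noteq> -\<infinity>"
      using lsc_on_vector_potential[OF ker radon mass clo nullAc I disj kbdd[unfolded Acp Acm]
        kcont[unfolded Acp Acm] kfin[unfolded Acp Acm] i] by blast+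
    have fopen: "open {x. t < f i x}" and ffin: "f i x \<noteq> -\<infinity>" for t x
      using fPsi[OF i] unfolding Psi_class_def by blast+
    have "continuous_on (Ac i) (\<lambda>x. - (w i * g i x))"
      using continuous_on_subset[OF gcont[OF i]] by (intro continuous_intros) auto
    then have "continuous_on (Ac i) (\<lambda>x. ereal (- (w i * g i x)))"
      by (rule continuous_on_ereal)
    then have "lsc_on (Ac i) (\<lambda>x. vector_potential \<kappa> Ipos Ineg lam i x + f i x + ereal (- (w i * g i x)))"
      using Vfin ffin
      by (intro lsc_on_add_ereal V lsc_onI_open[OF fopen] lsc_on_continuous) auto
    then show ?thesis unfolding H_def W weighted_potential_def .
  qed
  have suppAc: "msupport (lam i) \<subseteq> Ac i" if i: "i \<in> I" for i
    by (rule msupport_subset_closed[OF clo[OF i] nullAc[OF i]])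
  have suppb: "msupport (lam i) \<in> sets borel" for i
    using open_Compl_msupport[of "lam i"] by (simp add: closed_def borel_closed)
  have ae_supp: "AE x in lam i. x \<in> msupport (lam i)" if i: "i \<in> I" for i
    using emeasure_Compl_msupport[OF radon[OF i]] suppb
    by (intro AE_I[of _ _ "- msupport (lam i)"]) (auto simp: radon_measure_sets[OF radon[OF i]])
  \<comment> \<open>The exceptional set is Borel because the support lies in \<open>Ac i\<close>,
    where \<open>H i\<close> is semicontinuous; a Borel set is needed to pass from capacity zero to
    measure zero.\<close>
  define E where "E i = {x \<in> msupport (lam i). H i x \<noteq> 0}" for i
  have Eb: "E i \<in> sets borel" if i: "i \<in> I" for i
  proof -
    have [measurable]: "H i \<in> borel_measurable (restrict_space borel (Ac i))"
      by (rule lsc_on_measurable[OF lscH[OF i] Acb[OF i]])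
    have "{x \<in> space (restrict_space borel (Ac i)). H i x \<noteq> 0} \<in> sets (restrict_space borel (Ac i))"
      by measurable
    then have "{x \<in> Ac i. H i x \<noteq> 0} \<in> sets borel"
      using Acb[OF i] by (simp add: space_restrict_space sets_restrict_space_iff)
    then have "msupport (lam i) \<inter> {x \<in> Ac i. H i x \<noteq> 0} \<in> sets borel" using suppb by auto
    moreover have "E i = msupport (lam i) \<inter> {x \<in> Ac i. H i x \<noteq> 0}"
      using suppAc[OF i] by (auto simp: E_def)
    ultimately show ?thesis by simp
  qed
  have upper: "(\<forall>x\<in>msupport (lam i). H i x \<le> 0) \<longleftrightarrow> (AE x in lam i. H i x \<le> 0)" if i: "i \<in> I" for i
  proof
    assume "\<forall>x\<in>msupport (lam i). H i x \<le> 0"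
    then show "AE x in lam i. H i x \<le> 0" using ae_supp[OF i] by (auto elim: eventually_mono)
  next
    assume "AE x in lam i. H i x \<le> 0"
    then show "\<forall>x\<in>msupport (lam i). H i x \<le> 0"
      using lsc_on_le_msupport[OF radon[OF i] lscH[OF i] clo[OF i] nullAc[OF i]] by blast
  qed
  have equal: "nearly_everywhere \<kappa> (msupport (lam i)) (\<lambda>x. H i x = 0) \<longleftrightarrow> (AE x in lam i. H i x = 0)"
    if i: "i \<in> I - I0" for i
  proof
    have iI: "i \<in> I" using i by simp
    assume "nearly_everywhere \<kappa> (msupport (lam i)) (\<lambda>x. H i x = 0)"
    then have "inner_capacity \<kappa> (E i) = 0" by (simp add: nearly_everywhere_def E_def)
    then have "emeasure (lam i) (E i) = 0"
      using Eb[OF iI] mfin[OF iI] energy[OF iI]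
      by (intro capacity_zero_imp_null[OF pd radon[OF iI]]) auto
    then have "E i \<in> null_sets (lam i)"
      using Eb[OF iI] by (intro null_setsI) (simp_all add: radon_measure_sets[OF radon[OF iI]])
    then have "AE x in lam i. x \<notin> E i" by (rule AE_not_in)
    then show "AE x in lam i. H i x = 0"
      using ae_supp[OF iI] by eventually_elim (simp add: E_def)
  next
    have iI: "i \<in> I" using i by simp
    assume "AE x in lam i. H i x = 0"
    then have "AE x in lam i. H i x \<le> 0" by (auto elim: eventually_mono)
    then have le: "\<forall>x\<in>msupport (lam i). H i x \<le> 0" using upper[OF iI] by blast
    have cap: "inner_capacity \<kappa> {x \<in> A i. \<not> 0 \<le> H i x} = 0"
      using ne[OF i] by (simp add: nearly_everywhere_def H_iff)
    \<comment> \<open>An arbitrary competitor \<nu> is tested on the two pieces of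
      \<open>E i\<close> separately, so only subadditivity of \<nu> is invoked, not that of the
      capacity.\<close>
    have "inner_capacity \<kappa> (E i) = 0"
    proof (rule capacity_zeroI)
      fix \<nu> assume nu: "radon_measure \<nu>" "mutual_energy \<kappa> \<nu> \<nu> \<noteq> \<infinity>" and "emeasure (completion \<nu>) (E i) = 1"
      then have E1: "emeasure \<nu> (E i) = 1"
        using Eb[OF iI] by (simp add: radon_measure_sets[OF nu(1)])
      have fin: "emeasure \<nu> B < \<infinity>" if "B \<subseteq> E i" for B
      proof -
        have "emeasure \<nu> B \<le> emeasure \<nu> (E i)"
          using that Eb[OF iI] by (intro emeasure_mono) (simp_all add: radon_measure_sets[OF nu(1)])
        then show ?thesis using E1 by (auto simp: less_top[symmetric] top_unique)
      qed
      \<comment> \<open>On the support \<open>H i\<close> is already at most 0 everywhere, so being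
        nonzero there means being negative, which the lower bound permits only on a set of capacity
        zero.\<close>
      have sub: "E i \<inter> A i \<subseteq> {x \<in> A i. \<not> 0 \<le> H i x}"
        using le by (auto simp: E_def)
      have "emeasure \<nu> (E i \<inter> A i) = 0"
        using Eb[OF iI] Ab[OF iI] fin
        by (intro capacity_zero_imp_null[OF pd nu _ _ sub cap]) auto
      \<comment> \<open>Points of the support outside the plate lie in \<open>Ac i - A i\<close>,
        hence in the symmetric difference of capacity zero.\<close>
      moreover have "emeasure \<nu> (E i - A i) = 0"
        using Eb[OF iI] Ab[OF iI] fin suppAc[OF iI]
        by (intro capacity_zero_imp_null[OF pd nu _ _ _ capdiff[OF iI]]) (auto simp: E_def)
      moreover have "emeasure \<nu> (E i) \<le> emeasure \<nu> (E i \<inter> A i) + emeasure \<nu> (E i - A i)"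
        using emeasure_subadditive[of "E i \<inter> A i" \<nu> "E i - A i"] Eb[OF iI] Ab[OF iI]
        by (simp add: radon_measure_sets[OF nu(1)] Int_Diff_Un)
      ultimately show False using E1 by simp
    qed
    then show "nearly_everywhere \<kappa> (msupport (lam i)) (\<lambda>x. H i x = 0)"
      by (simp add: nearly_everywhere_def E_def)
  qed
  show ?thesis
    unfolding H_iff using upper equal I0 by blast
qed

end
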